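(* Let $G$ be a subgroup of $G(\mathbb{R};A,P)$ containing $B(\mathbb{R};A,P)$ and let $\psi\colon G\to P$ be the homomorphism $g\mapsto\sigma_\ell(g)\cdot\sigma_r(g)$. If the images of $\lambda\colon G\to\mathrm{Aff}(A,P)$ and of $\rho\colon G\to\mathrm{Aff}(A,P)$ are both non-abelian, then $\psi\circ\alpha=\psi$ for every automorphism $\alpha$ of $G$.
   Context: $P$ is a non-trivial subgroup of $\mathbb{R}^\times_{>0}$ and $A$ is a non-zero additive subgroup of $\mathbb{R}$ stable under multiplication by $P$. $\mathrm{PL}_o(\mathbb{R})$ is the group of orientation preserving piecewise linear homeomorphisms of $\mathbb{R}$ with finitely many break points (points where left and right derivative differ). $G(\mathbb{R};A,P)$ is the subgroup of all $g\in\mathrm{PL}_o(\mathbb{R})$ whose slopes lie in $P$, whose break points lie in $A$, and with $g(A)=A$. $B(\mathbb{R};A,P)$ is the subgroup of those $g\in G(\mathbb{R};A,P)$ that are the identity near $-\infty$ and near $+\infty$. $\mathrm{Aff}(A,P)$ is the group of affine maps $f$ of $\mathbb{R}$ with slope in $P$ and $f(0)\in A$. For $g\in G$, $\lambda(g)$ and $\rho(g)$ are the affine maps coinciding with $g$ near $-\infty$ and near $+\infty$, respectively, and $\sigma_\ell(g)$, $\sigma_r(g)$ are the slopes of $g$ near $-\infty$ and near $+\infty$, respectively. *)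

theory Defs
  imports "HOL-Analysis.Analysis" "HOL-Algebra.Bij"
begin

definition real_add_group :: "real monoid" where
  "real_add_group = \<lparr>carrier = UNIV, monoid.mult = (+), one = 0\<rparr>"

definition pos_real_mult_group :: "real monoid" where
  "pos_real_mult_group = \<lparr>carrier = {0<..}, monoid.mult = (*), one = 1\<rparr>"

definition affine_map :: "(real \<Rightarrow> real) \<Rightarrow> bool" where
  "affine_map f \<longleftrightarrow> (\<exists>p b. f = (\<lambda>x. p * x + b))"

text \<open>The set \<open>S\<close> is a locally finite set of subdivision points, possibly larger than the set
  of points where the slope actually changes.\<close>

definition piecewise_linear :: "(real \<Rightarrow> real) \<Rightarrow> bool" where
  "piecewise_linear g \<longleftrightarrow>
     (\<exists>S. (\<forall>u v. finite (S \<inter> {u..v})) \<and>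
          (\<forall>u v. {u<..<v} \<inter> S = {} \<longrightarrow> (\<exists>f. affine_map f \<and> (\<forall>x\<in>{u<..<v}. g x = f x))))"

definition break_points :: "(real \<Rightarrow> real) \<Rightarrow> real set" where
  "break_points g =
     {x. \<exists>l r. (g has_real_derivative l) (at_left x) \<and> (g has_real_derivative r) (at_right x) \<and>
              l \<noteq> r}"

definition slopes :: "(real \<Rightarrow> real) \<Rightarrow> real set" where
  "slopes g = {p. \<exists>x. (g has_real_derivative p) (at x)}"

definition PLo :: "(real \<Rightarrow> real) set" where
  "PLo = {g. (\<exists>h. homeomorphism UNIV UNIV g h) \<and> strict_mono g \<and>
             piecewise_linear g \<and> finite (break_points g)}"

definition PL :: "real set \<Rightarrow> real set \<Rightarrow> (real \<Rightarrow> real) set" where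
  "PL A P = {g \<in> PLo. slopes g \<subseteq> P \<and> break_points g \<subseteq> A \<and> g ` A = A}"

definition PL_bounded :: "real set \<Rightarrow> real set \<Rightarrow> (real \<Rightarrow> real) set" where
  "PL_bounded A P =
     {g \<in> PL A P. (\<forall>\<^sub>F x in at_bot. g x = x) \<and> (\<forall>\<^sub>F x in at_top. g x = x)}"

definition Aff :: "real set \<Rightarrow> real set \<Rightarrow> (real \<Rightarrow> real) set" where
  "Aff A P = {f. \<exists>p\<in>P. \<exists>b\<in>A. f = (\<lambda>x. p * x + b)}"

definition PL_group :: "real set \<Rightarrow> real set \<Rightarrow> (real \<Rightarrow> real) monoid" where
  "PL_group A P = BijGroup UNIV\<lparr>carrier := PL A P\<rparr>"

definition Aff_group :: "real set \<Rightarrow> real set \<Rightarrow> (real \<Rightarrow> real) monoid" where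
  "Aff_group A P = BijGroup UNIV\<lparr>carrier := Aff A P\<rparr>"

text \<open>The descriptions below denote the intended, unique objects whenever \<open>g \<in> PLo\<close>.\<close>

definition germ_left :: "(real \<Rightarrow> real) \<Rightarrow> real \<Rightarrow> real" where
  "germ_left g = (THE f. affine_map f \<and> (\<forall>\<^sub>F x in at_bot. g x = f x))"

definition germ_right :: "(real \<Rightarrow> real) \<Rightarrow> real \<Rightarrow> real" where
  "germ_right g = (THE f. affine_map f \<and> (\<forall>\<^sub>F x in at_top. g x = f x))"

definition slope_left :: "(real \<Rightarrow> real) \<Rightarrow> real" where
  "slope_left g = (THE p. \<forall>\<^sub>F x in at_bot. (g has_real_derivative p) (at x))"

definition slope_right :: "(real \<Rightarrow> real) \<Rightarrow> real" where
  "slope_right g = (THE p. \<forall>\<^sub>F x in at_top. (g has_real_derivative p) (at x))"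

definition psi :: "(real \<Rightarrow> real) \<Rightarrow> real" where
  "psi g = slope_left g * slope_right g"

end

theory Submission
  imports Defs
begin

text \<open>
  The proof has two halves. The first one is a reconstruction theorem: every automorphism
  \<open>\<alpha>\<close> of \<open>G\<close> is conjugation by a homeomorphism \<open>\<phi>\<close> of the line (lemma
  \<open>induced_by_conjugation\<close>). It uses only that \<open>G\<close> consists of increasing bijections and
  that inside every open interval some element supported there moves a given point to the
  right (locale \<open>locally_moving\<close>). Rubin's commutator formula describes, in the language of
  groups, when two elements have disjoint supports (lemma \<open>alg_disjoint_iff\<close>), so \<open>\<alpha>\<close>
  respects this relation and commutes with the operation \<open>polar\<close> that sends a set of
  elements to the set of those disjoint from all of it. Bipolar sets correspond to regular
  open subsets \<open>U\<close> of the line, and conjugation by \<open>g\<close> turns \<open>U\<close> into its translate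
  \<open>g U\<close>. Among these sets the open half-lines are the proper nonempty sets that are comparable with all their translates:
  a set with two boundary points can be pushed inwards at one of them and outwards at the
  other (lemma \<open>half_cases\<close>). Hence \<open>\<alpha>\<close> permutes the rigid stabilisers of half-lines.
  Two of these are comparable under inclusion exactly if the half-lines point to the same
  side, so \<open>\<alpha>\<close> either keeps or exchanges the two families, and its action on the end
  points of half-lines is the monotone bijection \<open>\<phi>\<close>.

  The second half recovers slopes from dynamics. If the germs of \<open>G\<close> at an end of the line
  do not all commute, then some commutator \<open>t\<close> has as its germ a translation by
  \<open>d \<noteq> 0\<close>, and if \<open>g\<close> has slope \<open>p\<close> there, then conjugating \<open>t\<close> by \<open>g\<close> gives the
  translation by \<open>p * d\<close>. The ratio \<open>p\<close> of the two translations can be read off from the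
  order of their orbits: for \<open>m, n > 0\<close> and \<open>x\<close> far out, \<open>t\<^sup>m x\<close> lies between \<open>x\<close> and
  \<open>s\<^sup>n x\<close>, where \<open>s\<close> is the conjugate of \<open>t\<close>, exactly if \<open>m < n * p\<close>. A monotone \<open>\<phi>\<close> preserves betweenness, whether
  it is increasing or decreasing, so the slope of \<open>\<alpha> g\<close> at the image end is \<open>p\<close> as well
  (lemma \<open>end_slope_invariant\<close>). An increasing \<open>\<phi>\<close> fixes both ends and preserves both
  slopes; a decreasing \<open>\<phi>\<close> exchanges the ends and the two slopes. The product of the slopes
  is unchanged in either case.
\<close>

section \<open>Supports of maps of the line\<close>

text \<open>From here on, \<open>inv\<close> denotes the inverse of a map and not of an element of a group record.\<close>

unbundle no m_inv_syntax

definition supp :: "(real \<Rightarrow> real) \<Rightarrow> real set" where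
  "supp f = {x. f x \<noteq> x}"

definition commutator :: "(real \<Rightarrow> real) \<Rightarrow> (real \<Rightarrow> real) \<Rightarrow> real \<Rightarrow> real" where
  "commutator f g = f \<circ> g \<circ> inv f \<circ> inv g"

lemma homeomorphism_of_strict_mono_surj:
  fixes g :: "real \<Rightarrow> real"
  assumes "strict_mono g" "surj g"
  shows "homeomorphism UNIV UNIV g (inv g)"
proof -
  have inj: "inj g" using assms(1) by (simp add: strict_mono_on_imp_inj_on)
  have c: "continuous_on UNIV g"
    by (rule continuous_onI_mono) (use assms in \<open>auto simp: strict_mono_less_eq\<close>)
  have "continuous_on UNIV (inv g)"
  proof (rule continuous_onI_mono)
    show "open (range (inv g))" using inj by (simp add: inj_imp_surj_inv)
    show "inv g x \<le> inv g y" if "x \<le> y" for x y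
      using that assms by (metis strict_mono_less_eq surj_f_inv_f)
  qed
  then show ?thesis using c inj assms(2)
    by (auto simp: homeomorphism_def inj_imp_surj_inv surj_f_inv_f)
qed

lemma supp_commute:
  assumes "supp f \<inter> supp g = {}" "inj f" "inj g"
  shows "f \<circ> g = g \<circ> f"
proof
  fix x
  consider "g x = x" "f x = x" | "g x = x" "f x \<noteq> x" | "f x = x" "g x \<noteq> x"
    using assms(1) by (auto simp: supp_def)
  then show "(f \<circ> g) x = (g \<circ> f) x"
  proof cases
    case 2
    then have "f (f x) \<noteq> f x" using assms(2) by (auto dest: injD)
    then have "g (f x) = f x" using assms(1) by (auto simp: supp_def)
    then show ?thesis using 2 by simp
  next
    case 3
    then have "g (g x) \<noteq> g x" using assms(3) by (auto dest: injD)
    then have "f (g x) = g x" using assms(1) by (auto simp: supp_def)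
    then show ?thesis using 3 by simp
  qed simp
qed

lemma supp_comp: "supp (f \<circ> g) \<subseteq> supp f \<union> supp g"
  by (auto simp: supp_def)

lemma supp_inv: "bij f \<Longrightarrow> supp (inv f) = supp f"
  unfolding supp_def by (auto simp: bij_inv_eq_iff) (metis bij_inv_eq_iff)+

lemma supp_conj: "bij g \<Longrightarrow> supp (g \<circ> f \<circ> inv g) = g ` supp f"
  unfolding supp_def by (auto simp: bij_inv_eq_iff image_iff bij_is_inj inv_f_f) (metis bij_inv_eq_iff)+

lemma commute_supp_invariant:
  assumes "f \<circ> g = g \<circ> f" "inj g" "x \<in> supp f"
  shows "g x \<in> supp f"
  using assms unfolding supp_def by (metis (mono_tags) comp_apply injD mem_Collect_eq)

section \<open>Locally moving groups of increasing bijections\<close>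

locale locally_moving =
  fixes G :: "(real \<Rightarrow> real) set"
  assumes comp: "f \<in> G \<Longrightarrow> g \<in> G \<Longrightarrow> f \<circ> g \<in> G"
    and inverse: "f \<in> G \<Longrightarrow> inv f \<in> G"
    and increasing: "f \<in> G \<Longrightarrow> strict_mono f"
    and onto: "f \<in> G \<Longrightarrow> surj f"
    and moves: "l < x \<Longrightarrow> x < r \<Longrightarrow> \<exists>g\<in>G. supp g \<subseteq> {l<..<r} \<and> x < g x"
begin

lemma bij: "f \<in> G \<Longrightarrow> bij f"
  by (simp add: bijI increasing onto strict_mono_on_imp_inj_on)

lemma inj: "f \<in> G \<Longrightarrow> inj f"
  by (simp add: bij bij_is_inj)

lemma inv_cancel [simp]: "f \<in> G \<Longrightarrow> inv f (f x) = x" "f \<in> G \<Longrightarrow> f (inv f x) = x"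
  by (simp_all add: inj onto surj_f_inv_f)

lemma less_iff [simp]: "f \<in> G \<Longrightarrow> f x < f y \<longleftrightarrow> x < y"
  by (simp add: increasing strict_mono_less)

lemma eq_iff [simp]: "f \<in> G \<Longrightarrow> f x = f y \<longleftrightarrow> x = y"
  by (simp add: inj inj_eq)

lemma inv_inv [simp]: "f \<in> G \<Longrightarrow> inv (inv f) = f"
  by (simp add: bij inv_inv_eq)

lemma id_in: "id \<in> G"
proof -
  obtain g where "g \<in> G" using moves[of 0 1 2] by auto
  moreover have "g \<circ> inv g = id" using \<open>g \<in> G\<close> by auto
  ultimately show ?thesis using comp inverse by metis
qed

lemma commutator_in: "f \<in> G \<Longrightarrow> g \<in> G \<Longrightarrow> commutator f g \<in> G"
  unfolding commutator_def by (intro comp inverse)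

lemma commutator_eq_id_iff:
  assumes "f \<in> G" "g \<in> G"
  shows "commutator f g = id \<longleftrightarrow> f \<circ> g = g \<circ> f"
proof
  assume h: "commutator f g = id"
  show "f \<circ> g = g \<circ> f"
  proof
    fix x
    have "commutator f g (g (f x)) = g (f x)" by (simp add: h)
    then show "(f \<circ> g) x = (g \<circ> f) x" using assms by (simp add: commutator_def)
  qed
next
  assume h: "f \<circ> g = g \<circ> f"
  show "commutator f g = id"
  proof
    fix x
    have "f (g (inv f (inv g x))) = g (f (inv f (inv g x)))" using fun_cong[OF h] by simp
    then show "commutator f g x = id x" using assms by (simp add: commutator_def)
  qed
qed

lemma isCont: "f \<in> G \<Longrightarrow> isCont f x"
  using homeomorphism_of_strict_mono_surj[of f] increasing onto
  by (simp add: homeomorphism_def continuous_on_eq_continuous_at)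

lemma open_supp: "f \<in> G \<Longrightarrow> open (supp f)"
  unfolding supp_def using isCont
  by (intro open_Collect_neq continuous_at_imp_continuous_on) auto

text \<open>
  Pushing can be iterated without overshooting. Otherwise let \<open>m\<close> be the supremum of the
  part of the orbit of \<open>x\<close> that is at most \<open>w\<close>. A map that moves \<open>m\<close> to the right and is
  supported so close to \<open>m\<close> that nothing jumps over the gap between \<open>w\<close> and \<open>w'\<close> carries
  orbit points near \<open>m\<close> beyond \<open>m\<close>.
\<close>

lemma push:
  assumes "l < x" "x \<le> w" "w < w'" "w' \<le> r"
  shows "\<exists>g\<in>G. supp g \<subseteq> {l<..<r} \<and> w < g x \<and> g x < w'"
proof (rule ccontr)
  assume no: "\<not> ?thesis"
  define Orb where "Orb = {g x | g. g \<in> G \<and> supp g \<subseteq> {l<..<r}}"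
  define m where "m = Sup (Orb \<inter> {..w})"
  have bdd: "bdd_above (Orb \<inter> {..w})" by (rule bdd_aboveI[of _ w]) auto
  have "x = id x \<and> supp id \<subseteq> {l<..<r}" by (simp add: supp_def)
  then have xO: "x \<in> Orb \<inter> {..w}" unfolding Orb_def using id_in assms by blast
  have xm: "x \<le> m" unfolding m_def using xO bdd by (rule cSup_upper)
  have mw: "m \<le> w" unfolding m_def using xO by (intro cSup_least) auto
  obtain f where f: "f \<in> G" "supp f \<subseteq> {max l (m - (w' - w))<..<min r (m + (w' - w))}" "m < f m"
    using moves[of "max l (m - (w' - w))" m "min r (m + (w' - w))"] assms xm mw by auto
  have "f (inv f m) < f m" using f by simp
  then have "inv f m < m" using f(1) less_iff by blast
  then obtain y where y: "y \<in> Orb \<inter> {..w}" "inv f m < y"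
    unfolding m_def using less_cSupD[of "Orb \<inter> {..w}"] xO by blast
  then obtain g where g: "y = g x" "g \<in> G" "supp g \<subseteq> {l<..<r}" by (auto simp: Orb_def)
  have "f (inv f m) < f y" using f(1) y(2) less_iff by blast
  then have fy: "m < f y" using f by simp
  have "y \<le> m" unfolding m_def using y(1) bdd by (rule cSup_upper)
  then have "y \<in> supp f" using fy by (auto simp: supp_def)
  then have "f y \<in> supp f" using f(1) by (simp add: supp_def)
  then have up: "f y < w'" using f(2) mw by auto
  have sub: "supp (f \<circ> g) \<subseteq> {l<..<r}"
    using supp_comp[of f g] g(3) f(2) by fastforce
  have "f y = (f \<circ> g) x" using g by simp
  then have "f y \<in> Orb" unfolding Orb_def using sub comp[OF f(1) g(2)] by blast
  then have "w < f y" using fy cSup_upper[OF _ bdd, of "f y"] by (force simp: m_def)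
  then show False using no up sub comp[OF f(1) g(2)] g(1) by auto
qed

text \<open>
  First push \<open>y\<close> with a map supported to the right of \<open>x\<close>; then push \<open>x\<close> with a map
  supported to the left of \<open>y\<close>, which leaves the new position of \<open>y\<close> alone.
\<close>

lemma push_two:
  assumes "x < y" "y < z" "y' < y" "z' < z"
  shows "\<exists>g\<in>G. y' < g x \<and> g x < y \<and> z' < g y \<and> g y < z"
proof -
  obtain f where f: "f \<in> G" "supp f \<subseteq> {(x + y) / 2<..<z}" "max y z' < f y" "f y < z"
    using push[of "(x + y) / 2" y "max y z'" z z] assms by auto
  obtain g where g: "g \<in> G" "supp g \<subseteq> {x - 1<..<y}" "max x y' < g x" "g x < y"
    using push[of "x - 1" x "max x y'" y y] assms by auto
  have "x \<notin> supp f" using f(2) assms by fastforce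
  moreover have "f y \<notin> supp g" using f(3) g(2) by fastforce
  ultimately have "f x = x" "g (f y) = f y" by (auto simp: supp_def)
  then show ?thesis using f g comp[OF g(1) f(1)] by (intro bexI[of _ "g \<circ> f"]) auto
qed

text \<open>
  If \<open>g\<close> moves \<open>x\<close> to the right, a map that moves \<open>x\<close> but fixes \<open>g x\<close> does not commute
  with \<open>g\<close>.
\<close>

lemma noncommuting_pair:
  assumes "l < r"
  shows "\<exists>f\<in>G. \<exists>g\<in>G. supp f \<subseteq> {l<..<r} \<and> supp g \<subseteq> {l<..<r} \<and> f \<circ> g \<noteq> g \<circ> f"
proof -
  obtain x where x: "l < x" "x < r" using assms dense by blast
  then obtain g where g: "g \<in> G" "supp g \<subseteq> {l<..<r}" "x < g x" using moves by blast
  have "g x \<in> supp g" using g by (auto simp: supp_def)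
  then have gr: "g x < r" using g by auto
  obtain f where f: "f \<in> G" "supp f \<subseteq> {l<..<g x}" "x < f x" using moves x g by blast
  have "g x \<notin> supp f" using f by auto
  then have "f (g x) = g x" by (simp add: supp_def)
  then have "f (g x) \<noteq> g (f x)" using f g by simp
  then have "f \<circ> g \<noteq> g \<circ> f" by (metis comp_apply)
  then show ?thesis using f g gr by (intro bexI[of _ f] bexI[of _ g]) auto
qed

text \<open>
  Rubin's first-order description of the relation ``disjoint supports''. Since it refers to
  nothing but the group operation, it is invariant under automorphisms.
\<close>

definition alg_disjoint :: "(real \<Rightarrow> real) \<Rightarrow> (real \<Rightarrow> real) \<Rightarrow> bool" where
  "alg_disjoint f g \<longleftrightarrow>
    (\<forall>h\<in>G. f \<circ> h \<noteq> h \<circ> f \<longrightarrow>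
      (\<exists>f1\<in>G. \<exists>f2\<in>G. f1 \<circ> g = g \<circ> f1 \<and> f2 \<circ> g = g \<circ> f2 \<and>
         commutator f1 (commutator f2 h) \<noteq> id \<and>
         commutator f1 (commutator f2 h) \<circ> g = g \<circ> commutator f1 (commutator f2 h)))"

text \<open>
  That all of the interval is moved beyond the same end point, and not just off itself,
  makes the statement pass to iterates of \<open>h\<close>.
\<close>

lemma displaced_interval:
  assumes "h \<in> G" "x \<in> supp h" "open U" "x \<in> U"
  shows "\<exists>l r. l < x \<and> x < r \<and> {l<..<r} \<subseteq> U \<and>
    ((\<forall>z. l < z \<longrightarrow> r < h z) \<or> (\<forall>z. z < r \<longrightarrow> h z < l))"
proof -
  obtain e where e: "e > 0" "{x - e<..<x + e} \<subseteq> U"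
    using assms(3,4) open_dist[of U] by (metis ball_eq_greaterThanLessThan openE)
  consider "x < h x" | "h x < x" using assms(2) by (force simp: supp_def)
  then show ?thesis
  proof cases
    case 1
    define r where "r = min (x + e) ((x + h x) / 2)"
    define l where "l = max (x - e) (inv h r)"
    have "r < h x" using 1 by (auto simp: r_def min_def)
    then have "h (inv h r) < h x" using assms(1) by simp
    then have "inv h r < x" using assms(1) less_iff by blast
    moreover have "r < h z" if "l < z" for z
    proof -
      have "inv h r < z" using that by (simp add: l_def)
      then have "h (inv h r) < h z" using assms(1) less_iff by blast
      then show ?thesis using assms(1) by simp
    qed
    ultimately show ?thesis using e 1
      by (intro exI[of _ l] exI[of _ r]) (auto simp: l_def r_def)
  next
    case 2
    define l where "l = max (x - e) ((x + h x) / 2)"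
    define r where "r = min (x + e) (inv h l)"
    have "h x < l" using 2 by (auto simp: l_def max_def)
    then have "h x < h (inv h l)" using assms(1) by simp
    then have "x < inv h l" using assms(1) less_iff by blast
    moreover have "h z < l" if "z < r" for z
    proof -
      have "z < inv h l" using that by (simp add: r_def)
      then have "h z < h (inv h l)" using assms(1) less_iff by blast
      then show ?thesis using assms(1) by simp
    qed
    ultimately show ?thesis using e 2
      by (intro exI[of _ l] exI[of _ r]) (auto simp: l_def r_def)
  qed
qed

text \<open>
  If \<open>h\<close> does not commute with \<open>f\<close>, it moves a point of the support of \<open>f\<close>, hence displaces
  an interval \<open>V\<close> around it inside this support. Take noncommuting \<open>f1\<close> and \<open>f2\<close> supported in
  \<open>V\<close>. The commutator of \<open>f2\<close> and \<open>h\<close> is \<open>f2\<close> times a map supported in \<open>h V\<close>, which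
  commutes with \<open>f1\<close>, so the double commutator collapses to that of \<open>f1\<close> and \<open>f2\<close>. Its
  support lies in \<open>V\<close>, where \<open>g\<close> is the identity.
\<close>

lemma alg_disjoint_if_disjoint:
  assumes "f \<in> G" "g \<in> G" "supp f \<inter> supp g = {}"
  shows "alg_disjoint f g"
  unfolding alg_disjoint_def
proof (intro ballI impI)
  fix h assume h: "h \<in> G" "f \<circ> h \<noteq> h \<circ> f"
  then obtain x where x: "x \<in> supp f" "x \<in> supp h"
    using supp_commute[of f h] inj assms by blast
  obtain l r where lr: "l < x" "x < r" "{l<..<r} \<subseteq> supp f"
      "(\<forall>z. l < z \<longrightarrow> r < h z) \<or> (\<forall>z. z < r \<longrightarrow> h z < l)"
    using displaced_interval[OF h(1) x(2) open_supp[OF assms(1)] x(1)] by blast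
  have disp: "h ` {l<..<r} \<inter> {l<..<r} = {}" using lr(4) by force
  obtain f1 f2 where f12: "f1 \<in> G" "f2 \<in> G" "supp f1 \<subseteq> {l<..<r}" "supp f2 \<subseteq> {l<..<r}"
      "f1 \<circ> f2 \<noteq> f2 \<circ> f1"
    using noncommuting_pair[of l r] lr by force
  have comm_g: "k \<circ> g = g \<circ> k" if "k \<in> G" "supp k \<subseteq> {l<..<r}" for k
    using that lr(3) assms(2,3) by (intro supp_commute) (auto intro: inj)
  define k where "k = h \<circ> inv f2 \<circ> inv h"
  have kG: "k \<in> G" unfolding k_def by (intro comp inverse h f12)
  have "supp k = h ` supp f2" unfolding k_def by (simp add: supp_conj supp_inv bij h f12)
  then have "supp f1 \<inter> supp k = {}" using disp f12 by blast
  then have f1k: "f1 \<circ> k = k \<circ> f1" using f12 kG by (intro supp_commute inj)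
  have f1k': "inv f1 (inv k y) = inv k (inv f1 y)" for y
  proof -
    have "k (f1 (inv f1 (inv k y))) = y" using f12 kG by simp
    moreover have "k (f1 (inv k (inv f1 y))) = f1 (k (inv k (inv f1 y)))"
      using fun_cong[OF f1k] by simp
    then have "k (f1 (inv k (inv f1 y))) = y" using f12 kG by simp
    ultimately have "k (f1 (inv f1 (inv k y))) = k (f1 (inv k (inv f1 y)))" by simp
    then show ?thesis using eq_iff f12(1) kG by blast
  qed
  have c2: "commutator f2 h = f2 \<circ> k" by (simp add: commutator_def k_def comp_assoc)
  have "inv (f2 \<circ> k) = inv k \<circ> inv f2" using f12 kG by (simp add: bij o_inv_distrib)
  then have w: "commutator f1 (commutator f2 h) = commutator f1 f2"
    unfolding c2 by (auto simp: commutator_def fun_eq_iff f1k' kG)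
  have "supp (commutator f1 f2) \<subseteq> {l<..<r}"
    unfolding commutator_def using f12 supp_inv[OF bij] by (auto dest!: subsetD[OF supp_comp])
  then have "commutator f1 f2 \<circ> g = g \<circ> commutator f1 f2" using comm_g commutator_in f12 by blast
  then show "\<exists>f1\<in>G. \<exists>f2\<in>G. f1 \<circ> g = g \<circ> f1 \<and> f2 \<circ> g = g \<circ> f2 \<and>
         commutator f1 (commutator f2 h) \<noteq> id \<and>
         commutator f1 (commutator f2 h) \<circ> g = g \<circ> commutator f1 (commutator f2 h)"
    using f12 comm_g commutator_eq_id_iff[of f1 f2] w
    by (intro bexI[of _ f1] bexI[of _ f2]) auto
qed

text \<open>
  At a common point of the two supports choose an interval \<open>V\<close> that is displaced by \<open>f\<close> and
  by all positive powers of \<open>g\<close>. Some nontrivial \<open>h\<close> supported in \<open>V\<close> fails to commute with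
  \<open>f\<close>, and the double commutator \<open>w\<close> supplied by algebraic disjointness is supported in four
  translates of \<open>V\<close> under maps that commute with \<open>g\<close>. An orbit of \<open>g\<close> meets each translate
  at most once. But \<open>w\<close> is nontrivial and commutes with \<open>g\<close>, so its support contains an
  entire forward orbit of \<open>g\<close>.
\<close>

lemma disjoint_if_alg_disjoint:
  assumes "f \<in> G" "g \<in> G" "alg_disjoint f g"
  shows "supp f \<inter> supp g = {}"
proof (rule ccontr)
  assume "\<not> ?thesis"
  then obtain x where x: "x \<in> supp f" "x \<in> supp g" by blast
  obtain l0 r0 where 0: "l0 < x" "x < r0" "(\<forall>z. l0 < z \<longrightarrow> r0 < f z) \<or> (\<forall>z. z < r0 \<longrightarrow> f z < l0)"
    using displaced_interval[OF assms(1) x(1) open_UNIV] by auto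
  obtain l r where lr: "l < x" "x < r" "{l<..<r} \<subseteq> {l0<..<r0}"
      "(\<forall>z. l < z \<longrightarrow> r < g z) \<or> (\<forall>z. z < r \<longrightarrow> g z < l)"
    using displaced_interval[OF assms(2) x(2) open_greaterThanLessThan[of l0 r0]] 0 by auto
  define V where "V = {l<..<r}"
  have disp_f: "f z \<notin> V" if "z \<in> V" for z
    using that lr(3) 0(3) unfolding V_def by fastforce
  \<comment> \<open>the intervals \<open>V\<close>, \<open>g V\<close>, \<open>g (g V)\<close>, \<dots> are pairwise disjoint\<close>
  have iter: "(g ^^ Suc n) z \<notin> V" if "z \<in> V" for n z
  proof -
    have "l < z \<longrightarrow> r < (g ^^ Suc n) z" if "\<forall>z. l < z \<longrightarrow> r < g z"
      using that lr by (induction n) force+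
    moreover have "z < r \<longrightarrow> (g ^^ Suc n) z < l" if "\<forall>z. z < r \<longrightarrow> g z < l"
      using that lr by (induction n) force+
    ultimately show ?thesis using lr(4) that by (force simp: V_def)
  qed
  obtain h where h: "h \<in> G" "supp h \<subseteq> V" "x < h x" unfolding V_def using moves lr by blast
  have xh: "x \<in> supp h" using h by (auto simp: supp_def)
  have "f \<circ> h \<noteq> h \<circ> f"
    using commute_supp_invariant[of h f x] disp_f[of x] h(2) xh inj[OF assms(1)] by (metis subsetD)
  then obtain f1 f2 where F: "f1 \<in> G" "f2 \<in> G" "f1 \<circ> g = g \<circ> f1" "f2 \<circ> g = g \<circ> f2"
      "commutator f1 (commutator f2 h) \<noteq> id"
      "commutator f1 (commutator f2 h) \<circ> g = g \<circ> commutator f1 (commutator f2 h)"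
    using assms(3) h(1) unfolding alg_disjoint_def by blast
  define w where "w = commutator f1 (commutator f2 h)"
  define k where "k = commutator f2 h"
  have kG: "k \<in> G" unfolding k_def by (intro commutator_in F h)
  have "supp k \<subseteq> supp (f2 \<circ> h \<circ> inv f2) \<union> supp (inv h)"
    unfolding k_def commutator_def by (rule supp_comp)
  also have "\<dots> = f2 ` supp h \<union> supp h" using F h by (simp add: supp_conj supp_inv bij)
  finally have sk: "supp k \<subseteq> V \<union> f2 ` V" using h by blast
  have "supp w \<subseteq> supp (f1 \<circ> k \<circ> inv f1) \<union> supp (inv k)"
    unfolding w_def k_def[symmetric] commutator_def[of f1] by (rule supp_comp)
  also have "\<dots> = f1 ` supp k \<union> supp k" using F kG by (simp add: supp_conj supp_inv bij)
  finally have "supp w \<subseteq> f1 ` supp k \<union> supp k" .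
  moreover have "f1 ` supp k \<subseteq> f1 ` V \<union> (f1 \<circ> f2) ` V"
    using image_mono[OF sk, of f1] by (simp add: image_Un image_comp)
  ultimately have sw: "supp w \<subseteq> V \<union> f2 ` V \<union> f1 ` V \<union> (f1 \<circ> f2) ` V"
    using sk by blast
  obtain y where y: "y \<in> supp w" using F(5) by (auto simp: supp_def w_def fun_eq_iff)
  have orbit: "(g ^^ n) y \<in> supp w" for n
  proof (induction n)
    case (Suc n)
    then show ?case using commute_supp_invariant[of w g] F(6) inj[OF assms(2)] by (simp add: w_def)
  qed (simp add: y)
  have fin: "finite {n. (g ^^ n) y \<in> c ` V}" if c: "c \<in> G" "c \<circ> g = g \<circ> c" for c
  proof -
    have "n = m" if nm: "(g ^^ n) y \<in> c ` V" "(g ^^ m) y \<in> c ` V" "n \<le> m" for n m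
    proof (rule ccontr)
      assume "n \<noteq> m"
      then obtain j where j: "m = Suc j + n" using nm(3) by (metis add.commute le_neq_implies_less less_iff_Suc_add add_Suc_right)
      obtain z where z: "z \<in> V" "(g ^^ n) y = c z" using nm by blast
      obtain z' where z': "z' \<in> V" "(g ^^ m) y = c z'" using nm by blast
      have cg: "(g ^^ i) (c u) = c ((g ^^ i) u)" for i u
        by (induction i) (use fun_cong[OF c(2)] in auto)
      have "c z' = (g ^^ Suc j) ((g ^^ n) y)" using z' j by (metis comp_apply funpow_add)
      then have "c z' = c ((g ^^ Suc j) z)" using cg z by metis
      then have "z' = (g ^^ Suc j) z" using eq_iff[OF c(1)] by blast
      then show False using iter z(1) z'(1) by blast
    qed
    then have "\<exists>N. {n. (g ^^ n) y \<in> c ` V} \<subseteq> {N}" by (metis (mono_tags, lifting) insertI1 mem_Collect_eq nle_le subsetI)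
    then show ?thesis using finite_subset by blast
  qed
  have "(UNIV :: nat set) \<subseteq> {n. (g ^^ n) y \<in> id ` V} \<union> {n. (g ^^ n) y \<in> f2 ` V}
      \<union> {n. (g ^^ n) y \<in> f1 ` V} \<union> {n. (g ^^ n) y \<in> (f1 \<circ> f2) ` V}"
  proof
    fix n :: nat
    have "(g ^^ n) y \<in> V \<union> f2 ` V \<union> f1 ` V \<union> (f1 \<circ> f2) ` V" using orbit[of n] sw by (rule rev_subsetD)
    then show "n \<in> {n. (g ^^ n) y \<in> id ` V} \<union> {n. (g ^^ n) y \<in> f2 ` V}
      \<union> {n. (g ^^ n) y \<in> f1 ` V} \<union> {n. (g ^^ n) y \<in> (f1 \<circ> f2) ` V}" by simp
  qed
  moreover have "(f1 \<circ> f2) \<circ> g = g \<circ> (f1 \<circ> f2)" using F(3,4) by (metis comp_assoc)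
  ultimately have "finite (UNIV :: nat set)"
    using fin[of id] fin[of f1] fin[of f2] fin[of "f1 \<circ> f2"] F id_in comp finite_subset
    by (metis (no_types, lifting) comp_id id_comp finite_UnI)
  then show False by simp
qed

lemma alg_disjoint_iff:
  "f \<in> G \<Longrightarrow> g \<in> G \<Longrightarrow> alg_disjoint f g \<longleftrightarrow> supp f \<inter> supp g = {}"
  using alg_disjoint_if_disjoint disjoint_if_alg_disjoint by blast

end

section \<open>Half-lines seen by the group\<close>

context locally_moving
begin

definition rigid :: "real set \<Rightarrow> (real \<Rightarrow> real) set" where
  "rigid U = {g \<in> G. supp g \<subseteq> U}"

definition polar :: "(real \<Rightarrow> real) set \<Rightarrow> (real \<Rightarrow> real) set" where
  "polar X = {g \<in> G. \<forall>x\<in>X. supp g \<inter> supp x = {}}"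

definition conj_set :: "(real \<Rightarrow> real) \<Rightarrow> (real \<Rightarrow> real) set \<Rightarrow> (real \<Rightarrow> real) set" where
  "conj_set g X = (\<lambda>f. g \<circ> f \<circ> inv g) ` X"

text \<open>
  Both kinds of half-lines are treated at once, which makes the two cases of the
  reconstruction, \<open>\<phi>\<close> increasing and \<open>\<phi>\<close> decreasing, into one.
\<close>

definition ray :: "bool \<Rightarrow> real \<Rightarrow> real set" where
  "ray e a = (if e then {..<a} else {a<..})"

text \<open>
  A condition in terms of conjugation, inclusion and disjointness of supports only, which
  turns out to single out the rigid stabilisers of half-lines.
\<close>

definition half :: "(real \<Rightarrow> real) set \<Rightarrow> bool" where
  "half X \<longleftrightarrow> X \<subseteq> G \<and> polar (polar X) = X \<and> X \<noteq> {id} \<and> polar X \<noteq> {id} \<and>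
     (\<forall>g\<in>G. conj_set g X \<subseteq> X \<or> X \<subseteq> conj_set g X)"

lemma supp_eq_empty_iff: "supp f = {} \<longleftrightarrow> f = id"
  by (auto simp: supp_def fun_eq_iff)

lemma supp_id [simp]: "supp id = {}"
  by (simp add: supp_eq_empty_iff)

lemma rigid_neq: "l < r \<Longrightarrow> {l<..<r} \<subseteq> U \<Longrightarrow> rigid U \<noteq> {id}"
proof -
  assume "l < r" "{l<..<r} \<subseteq> U"
  then obtain g where "g \<in> G" "supp g \<subseteq> U" "(l + r) / 2 < g ((l + r) / 2)"
    using moves[of l "(l + r) / 2" r] by auto
  then have "g \<in> rigid U" "g \<noteq> id" by (auto simp: rigid_def)
  then show ?thesis by blast
qed

lemma polar_rigid_ray: "polar (rigid (ray e a)) = rigid (ray (\<not> e) a)"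
proof
  show "polar (rigid (ray e a)) \<subseteq> rigid (ray (\<not> e) a)"
  proof
    fix g assume g: "g \<in> polar (rigid (ray e a))"
    have "x \<notin> supp g" if "x \<in> ray e a" for x
    proof -
      obtain l r where lr: "l < x" "x < r" "{l<..<r} \<subseteq> ray e a"
        using \<open>x \<in> ray e a\<close> by (cases e; force simp: ray_def intro: that[of "x-1" a] that[of a "x+1"])
      then obtain f where "f \<in> G" "supp f \<subseteq> {l<..<r}" "x < f x" using moves by blast
      then have "f \<in> rigid (ray e a)" "x \<in> supp f" using lr by (auto simp: rigid_def supp_def)
      then show ?thesis using g by (auto simp: polar_def)
    qed
    moreover have "a \<notin> supp g"
    proof
      \<comment> \<open>the support of \<open>g\<close> is open, so with \<open>a\<close> it would contain points on both sides of \<open>a\<close>\<close>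
      assume a: "a \<in> supp g"
      obtain r where r: "r > 0" "ball a r \<subseteq> supp g"
        using g a open_supp[of g] by (auto simp: polar_def open_contains_ball)
      have "a + r / 2 \<in> supp g" "a - r / 2 \<in> supp g" using r by (auto intro!: subsetD[OF r(2)] simp: dist_real_def)
      moreover have "a + r / 2 \<in> ray e a \<or> a - r / 2 \<in> ray e a" using r by (auto simp: ray_def)
      ultimately show False using \<open>\<And>x. x \<in> ray e a \<Longrightarrow> x \<notin> supp g\<close> by blast
    qed
    ultimately have "supp g \<subseteq> ray (\<not> e) a"
      by (auto simp: ray_def not_less_iff_gr_or_eq) (metis linorder_neqE_linordered_idom)+
    then show "g \<in> rigid (ray (\<not> e) a)" using g by (simp add: rigid_def polar_def)
  qed
  show "rigid (ray (\<not> e) a) \<subseteq> polar (rigid (ray e a))"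
    by (fastforce simp: rigid_def polar_def ray_def split: if_splits)
qed

text \<open>
  Comparability of rigid stabilisers thus detects whether two half-lines point to the same
  side, and the inclusion order detects the order of their end points.
\<close>

lemma rigid_ray_subset_iff:
  "rigid (ray e a) \<subseteq> rigid (ray d b) \<longleftrightarrow> d = e \<and> (if e then a \<le> b else b \<le> a)"
proof
  assume sub: "rigid (ray e a) \<subseteq> rigid (ray d b)"
  have *: "x \<in> ray d b" if "x \<in> ray e a" for x
  proof -
    obtain l r where lr: "l < x" "x < r" "{l<..<r} \<subseteq> ray e a"
      using \<open>x \<in> ray e a\<close> by (cases e; force simp: ray_def intro: that[of "x-1" a] that[of a "x+1"])
    then obtain f where f: "f \<in> G" "supp f \<subseteq> {l<..<r}" "x < f x" using moves by blast
    then have "f \<in> rigid (ray e a)" using lr by (auto simp: rigid_def)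
    then have "f \<in> rigid (ray d b)" using sub by blast
    then show ?thesis using f by (auto simp: rigid_def supp_def)
  qed
  have "ray e a \<subseteq> ray d b" using * by blast
  moreover have "min a b - 1 < a" "min a b - 1 < b" "a < max a b + 1" "b < max a b + 1"
    by linarith+
  ultimately show "d = e \<and> (if e then a \<le> b else b \<le> a)"
    using *[of "min a b - 1"] *[of "max a b + 1"] by (cases d; cases e) (auto simp: ray_def)
qed (auto simp: rigid_def ray_def split: if_splits)

lemma rigid_ray_eq_iff [simp]: "rigid (ray e a) = rigid (ray d b) \<longleftrightarrow> e = d \<and> a = b"
  using rigid_ray_subset_iff[of e a d b] rigid_ray_subset_iff[of d b e a]
  by (metis order_antisym order_refl)

lemma conj_set_rigid:
  assumes "g \<in> G"
  shows "conj_set g (rigid U) = rigid (g ` U)"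
proof
  show "conj_set g (rigid U) \<subseteq> rigid (g ` U)"
  proof
    fix k assume "k \<in> conj_set g (rigid U)"
    then obtain f where f: "f \<in> G" "supp f \<subseteq> U" "k = g \<circ> f \<circ> inv g"
      by (auto simp: conj_set_def rigid_def)
    have "supp k \<subseteq> g ` U" unfolding f(3) using assms f(2) by (simp add: supp_conj bij image_mono)
    then show "k \<in> rigid (g ` U)" using f assms by (simp add: rigid_def comp inverse)
  qed
  show "rigid (g ` U) \<subseteq> conj_set g (rigid U)"
  proof
    fix f assume f: "f \<in> rigid (g ` U)"
    define k where "k = inv g \<circ> f \<circ> inv (inv g)"
    have "supp k = inv g ` supp f" unfolding k_def
      using assms by (intro supp_conj bij inverse)
    also have "\<dots> \<subseteq> inv g ` (g ` U)" using f by (auto simp: rigid_def)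
    also have "\<dots> = U" using assms by (simp add: image_comp)
    finally have "k \<in> rigid U" using f assms by (auto simp: rigid_def k_def intro!: comp inverse)
    moreover have "g \<circ> k \<circ> inv g = f" using assms by (auto simp: k_def)
    ultimately show "f \<in> conj_set g (rigid U)" by (force simp: conj_set_def)
  qed
qed

lemma image_ray:
  assumes "g \<in> G"
  shows "g ` ray e a = ray e (g a)"
proof -
  have "y \<in> g ` ray e a" if "y \<in> ray e (g a)" for y
  proof -
    have "g (inv g y) = y" using assms by simp
    then have "inv g y \<in> ray e a" using that assms less_iff
      by (metis greaterThan_iff lessThan_iff ray_def)
    then show ?thesis using \<open>g (inv g y) = y\<close> by (metis imageI)
  qed
  then show ?thesis using assms by (auto simp: ray_def)
qed

lemma half_rigid_ray: "half (rigid (ray e a))"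
proof -
  have "rigid (ray e a) \<noteq> {id}" for e
    using rigid_neq[of "a - 1" a "ray e a"] rigid_neq[of a "a + 1" "ray e a"]
    by (cases e) (auto simp: ray_def subset_iff)
  then show ?thesis
    by (auto simp: half_def polar_rigid_ray conj_set_rigid image_ray rigid_ray_subset_iff)
       (auto simp: rigid_def)
qed

text \<open>
  Let \<open>U\<close> and \<open>V\<close> be the unions of the supports of \<open>X\<close> and of its polar. They are disjoint
  open sets, and \<open>U\<close> is comparable with all its translates. If neither lies entirely to the
  left of the other, there are three points that lie alternately in \<open>U\<close> and \<open>V\<close>; moving the
  first near the second and the second near the third takes a point of \<open>U\<close> into \<open>V\<close> and a
  point of \<open>V\<close> into \<open>U\<close>, and then \<open>g U\<close> and \<open>U\<close> are incomparable. So a half-line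
  separates \<open>U\<close> from \<open>V\<close>, and since \<open>X\<close> is bipolar it contains all elements supported there.
\<close>

lemma half_cases:
  assumes "half X"
  obtains e a where "X = rigid (ray e a)"
proof -
  define U where "U = \<Union> (supp ` X)"
  define V where "V = \<Union> (supp ` polar X)"
  have X: "X \<subseteq> G" "polar (polar X) = X" "X \<noteq> {id}" "polar X \<noteq> {id}"
      "\<And>g. g \<in> G \<Longrightarrow> conj_set g X \<subseteq> X \<or> X \<subseteq> conj_set g X"
    using assms by (auto simp: half_def)
  have disj: "U \<inter> V = {}" by (auto simp: U_def V_def polar_def)
  have "id \<in> polar Y" for Y using id_in by (simp add: polar_def)
  then have "id \<in> X" "id \<in> polar X" using X(2) by (metis, metis)
  then have "U \<noteq> {}" "V \<noteq> {}"
    using X(3,4) supp_eq_empty_iff unfolding U_def V_def by blast+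
  have opU: "open U" and opV: "open V"
    using X(1) open_supp by (auto simp: U_def V_def polar_def)
  have comparable: "g ` U \<subseteq> U \<or> U \<subseteq> g ` U" if "g \<in> G" for g
  proof -
    have "\<Union> (supp ` conj_set g X) = g ` U"
      using that X(1) by (auto simp: conj_set_def U_def supp_conj bij)
    then show ?thesis using X(5)[OF that] unfolding U_def by blast
  qed
  have no: False if "g \<in> G" "u \<in> U" "g u \<in> V" "v \<in> V" "g v \<in> U" for g u v
  proof -
    have "g v \<notin> g ` U" using that disj by auto
    then show False using comparable[OF that(1)] that disj by blast
  qed
  have below: "\<exists>y' < y. {y'<..<y} \<subseteq> W" if "open W" "y \<in> W" for W and y :: real
    using open_left[OF that, of "y - 1"] by force
  have sep: "(\<forall>u\<in>U. \<forall>v\<in>V. u < v) \<or> (\<forall>u\<in>U. \<forall>v\<in>V. v < u)"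
  proof (rule ccontr)
    assume "\<not> ?thesis"
    then obtain u v u' v' where uv: "u \<in> U" "v \<in> V" "u' \<in> U" "v' \<in> V" "v < u" "u' < v'"
      using disj by (metis IntI empty_iff linorder_neqE_linordered_idom)
    then consider x y z where "x < y" "y < z" "x \<in> V" "y \<in> U" "z \<in> V"
      | x y z where "x < y" "y < z" "x \<in> U" "y \<in> V" "z \<in> U"
      using disj by (metis IntI empty_iff linorder_neqE_linordered_idom)
    then show False
    proof cases
      case 1
      obtain y' where y': "y' < y" "{y'<..<y} \<subseteq> U" using below[OF opU] 1 by blast
      obtain z' where z': "z' < z" "{z'<..<z} \<subseteq> V" using below[OF opV] 1 by blast
      obtain g where "g \<in> G" "y' < g x" "g x < y" "z' < g y" "g y < z"
        using push_two[of x y z y' z'] 1 y' z' by blast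
      then show False using no[of g y x] 1 subsetD[OF y'(2), of "g x"] subsetD[OF z'(2), of "g y"] by simp
    next
      case 2
      obtain y' where y': "y' < y" "{y'<..<y} \<subseteq> V" using below[OF opV] 2 by blast
      obtain z' where z': "z' < z" "{z'<..<z} \<subseteq> U" using below[OF opU] 2 by blast
      obtain g where "g \<in> G" "y' < g x" "g x < y" "z' < g y" "g y < z"
        using push_two[of x y z y' z'] 2 y' z' by blast
      then show False using no[of g x y] 2 subsetD[OF y'(2), of "g x"] subsetD[OF z'(2), of "g y"] by simp
    qed
  qed
  have "\<exists>e a. U \<subseteq> ray e a \<and> ray e a \<inter> V = {}"
    using sep
  proof
    assume less: "\<forall>u\<in>U. \<forall>v\<in>V. u < v"
    define a where "a = Sup U"
    obtain v0 where "v0 \<in> V" using \<open>V \<noteq> {}\<close> by blast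
    then have bdd: "bdd_above U" using less by (intro bdd_aboveI[of _ v0]) force
    have "u < a" if u: "u \<in> U" for u
    proof -
      obtain d where "d > 0" "ball u d \<subseteq> U" using opU u open_contains_ball by blast
      then have "u + d / 2 \<in> U" by (auto simp: dist_real_def subset_iff)
      then have "u + d / 2 \<le> a" unfolding a_def by (rule cSup_upper[OF _ bdd])
      then show ?thesis using \<open>d > 0\<close> by simp
    qed
    moreover have "a \<le> v" if "v \<in> V" for v
      unfolding a_def using less that \<open>U \<noteq> {}\<close> by (intro cSup_least) (auto intro: less_imp_le)
    ultimately show ?thesis by (intro exI[of _ True] exI[of _ a]) (force simp: ray_def)
  next
    assume less: "\<forall>u\<in>U. \<forall>v\<in>V. v < u"
    define a where "a = Inf U"
    obtain v0 where "v0 \<in> V" using \<open>V \<noteq> {}\<close> by blast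
    then have bdd: "bdd_below U" using less by (intro bdd_belowI[of _ v0]) force
    have "a < u" if u: "u \<in> U" for u
    proof -
      obtain d where "d > 0" "ball u d \<subseteq> U" using opU u open_contains_ball by blast
      then have "u - d / 2 \<in> U" by (auto simp: dist_real_def subset_iff)
      then have "a \<le> u - d / 2" unfolding a_def by (rule cInf_lower[OF _ bdd])
      then show ?thesis using \<open>d > 0\<close> by simp
    qed
    moreover have "v \<le> a" if "v \<in> V" for v
      unfolding a_def using less that \<open>U \<noteq> {}\<close> by (intro cInf_greatest) (auto intro: less_imp_le)
    ultimately show ?thesis by (intro exI[of _ False] exI[of _ a]) (force simp: ray_def)
  qed
  then obtain e a where ea: "U \<subseteq> ray e a" "ray e a \<inter> V = {}" by blast
  have "X \<subseteq> rigid (ray e a)" using X(1) ea(1) by (auto simp: rigid_def U_def)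
  moreover have "rigid (ray e a) \<subseteq> polar (polar X)"
    using ea(2) by (fastforce simp: rigid_def polar_def V_def)
  ultimately show thesis using X(2) that by blast
qed

end

section \<open>Automorphisms are conjugations by homeomorphisms\<close>

locale automorphism = locally_moving +
  fixes \<alpha> :: "(real \<Rightarrow> real) \<Rightarrow> (real \<Rightarrow> real)"
  assumes bijective: "bij_betw \<alpha> G G"
    and hom: "f \<in> G \<Longrightarrow> g \<in> G \<Longrightarrow> \<alpha> (f \<circ> g) = \<alpha> f \<circ> \<alpha> g"
begin

lemma closed [simp]: "f \<in> G \<Longrightarrow> \<alpha> f \<in> G"
  using bij_betwE[OF bijective] by simp

lemma alpha_eq_iff: "f \<in> G \<Longrightarrow> g \<in> G \<Longrightarrow> \<alpha> f = \<alpha> g \<longleftrightarrow> f = g"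
  using bijective by (auto simp: bij_betw_def dest: inj_onD)

lemma preimage: "g \<in> G \<Longrightarrow> \<exists>f\<in>G. \<alpha> f = g"
  using bijective by (metis bij_betw_imp_surj_on imageE)

lemma map_id: "\<alpha> id = id"
proof
  fix x
  have "\<alpha> id (\<alpha> id x) = \<alpha> id x" using hom[OF id_in id_in] by (metis comp_apply comp_id)
  then show "\<alpha> id x = id x" using id_in eq_iff[of "\<alpha> id"] by simp
qed

lemma map_inv:
  assumes "f \<in> G"
  shows "\<alpha> (inv f) = inv (\<alpha> f)"
proof
  fix x
  have "f \<circ> inv f = id" using assms by auto
  then have "\<alpha> f \<circ> \<alpha> (inv f) = id" using hom[of f "inv f"] map_id inverse assms by simp
  then have "\<alpha> f (\<alpha> (inv f) x) = \<alpha> f (inv (\<alpha> f) x)" using assms by (simp add: fun_eq_iff)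
  then show "\<alpha> (inv f) x = inv (\<alpha> f) x" using assms by (metis closed inv_cancel(1))
qed

lemma map_commutator:
  "f \<in> G \<Longrightarrow> g \<in> G \<Longrightarrow> \<alpha> (commutator f g) = commutator (\<alpha> f) (\<alpha> g)"
  by (simp add: commutator_def hom map_inv comp inverse)

lemma map_commute_iff:
  "f \<in> G \<Longrightarrow> g \<in> G \<Longrightarrow> \<alpha> f \<circ> \<alpha> g = \<alpha> g \<circ> \<alpha> f \<longleftrightarrow> f \<circ> g = g \<circ> f"
  using alpha_eq_iff[of "f \<circ> g" "g \<circ> f"] by (simp add: hom comp)

lemma inverse_automorphism: "automorphism G (inv_into G \<alpha>)"
proof
  show "bij_betw (inv_into G \<alpha>) G G" using bijective by (rule bij_betw_inv_into)
  fix f g assume "f \<in> G" "g \<in> G"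
  then obtain f' g' where "f' \<in> G" "g' \<in> G" "f = \<alpha> f'" "g = \<alpha> g'" using preimage by metis
  then show "inv_into G \<alpha> (f \<circ> g) = inv_into G \<alpha> f \<circ> inv_into G \<alpha> g"
    using bijective by (simp add: hom[symmetric] comp bij_betw_inv_into_left)
qed

lemma disjoint_supp_iff:
  assumes "f \<in> G" "g \<in> G"
  shows "supp (\<alpha> f) \<inter> supp (\<alpha> g) = {} \<longleftrightarrow> supp f \<inter> supp g = {}"
proof -
  \<comment> \<open>\<open>\<alpha>\<close> is onto, so all quantifiers in the formula may be restricted to values of \<open>\<alpha>\<close>\<close>
  have img: "(\<forall>h\<in>G. Q h) \<longleftrightarrow> (\<forall>h\<in>G. Q (\<alpha> h))" "(\<exists>h\<in>G. Q h) \<longleftrightarrow> (\<exists>h\<in>G. Q (\<alpha> h))" for Q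
    using preimage by (metis closed)+
  have eq_id: "\<alpha> f = id \<longleftrightarrow> f = id" if "f \<in> G" for f
    using alpha_eq_iff[OF that id_in] map_id by simp
  have "alg_disjoint (\<alpha> f) (\<alpha> g) \<longleftrightarrow> alg_disjoint f g"
    unfolding alg_disjoint_def
    apply (subst img(1))
    apply (subst (1) img(2))
    apply (subst (2) img(2))
    by (simp add: map_commutator[symmetric] map_commute_iff commutator_in eq_id assms cong: ball_cong bex_cong)
  then show ?thesis using assms by (simp add: alg_disjoint_iff)
qed

lemma image_polar:
  assumes "X \<subseteq> G"
  shows "\<alpha> ` polar X = polar (\<alpha> ` X)"
proof
  show "\<alpha> ` polar X \<subseteq> polar (\<alpha> ` X)"
    using assms by (auto simp: polar_def) (metis IntI disjoint_supp_iff emptyE subsetD)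
  show "polar (\<alpha> ` X) \<subseteq> \<alpha> ` polar X"
  proof
    fix g assume g: "g \<in> polar (\<alpha> ` X)"
    then have "g \<in> G" by (simp add: polar_def)
    then obtain f where f: "f \<in> G" "g = \<alpha> f" using preimage by metis
    then have "f \<in> polar X" using g assms by (auto simp: polar_def) (metis IntI disjoint_supp_iff emptyE subsetD)
    then show "g \<in> \<alpha> ` polar X" using f by blast
  qed
qed

lemma polar_subset: "polar X \<subseteq> G"
  by (auto simp: polar_def)

lemma image_conj_set:
  assumes "g \<in> G" "X \<subseteq> G"
  shows "\<alpha> ` conj_set g X = conj_set (\<alpha> g) (\<alpha> ` X)"
  unfolding conj_set_def image_image
  using assms by (intro image_cong) (auto simp: hom map_inv comp inverse subset_iff)

lemma image_subset_iff:
  "X \<subseteq> G \<Longrightarrow> Y \<subseteq> G \<Longrightarrow> \<alpha> ` X \<subseteq> \<alpha> ` Y \<longleftrightarrow> X \<subseteq> Y"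
  using bijective by (meson bij_betw_def inj_on_image_subset_iff)

lemma half_image:
  assumes "half X"
  shows "half (\<alpha> ` X)"
proof -
  have X: "X \<subseteq> G" using assms by (simp add: half_def)
  have img_id: "\<alpha> ` Y = {id} \<longleftrightarrow> Y = {id}" if "Y \<subseteq> G" for Y
    using image_subset_iff[of Y "{id}"] image_subset_iff[of "{id}" Y] that id_in map_id by auto
  have "conj_set g (\<alpha> ` X) \<subseteq> \<alpha> ` X \<or> \<alpha> ` X \<subseteq> conj_set g (\<alpha> ` X)" if g: "g \<in> G" for g
  proof -
    obtain k where k: "k \<in> G" "g = \<alpha> k" using preimage g by metis
    have "conj_set k X \<subseteq> G" using X k by (auto simp: conj_set_def intro!: comp inverse)
    then show ?thesis
      using assms k X image_conj_set[OF k(1) X] image_subset_iff by (metis half_def)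
  qed
  moreover have "\<alpha> ` X \<subseteq> G" using X by auto
  ultimately show ?thesis
    using assms X polar_subset by (auto simp: half_def image_polar[symmetric] img_id)
qed

lemma ray_image: "\<exists>d b. \<alpha> ` rigid (ray e a) = rigid (ray d b)"
  using half_image[OF half_rigid_ray] half_cases by metis

lemma rigid_subset: "rigid U \<subseteq> G"
  by (auto simp: rigid_def)

text \<open>
  Left half-lines are pairwise comparable, so their images all point to one side \<open>d\<close>; right
  half-lines are the polars of left ones.
\<close>

lemma rays_image:
  obtains d \<phi> where "\<And>e a. \<alpha> ` rigid (ray e a) = rigid (ray (e = d) (\<phi> a))"
proof -
  obtain d c where dc: "\<alpha> ` rigid (ray True 0) = rigid (ray d c)" using ray_image by blast
  have "\<exists>b. \<alpha> ` rigid (ray True a) = rigid (ray d b)" for a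
  proof -
    obtain d' b where d'b: "\<alpha> ` rigid (ray True a) = rigid (ray d' b)" using ray_image by blast
    have "rigid (ray True 0) \<subseteq> rigid (ray True a) \<or> rigid (ray True a) \<subseteq> rigid (ray True 0)"
      by (auto simp: rigid_ray_subset_iff)
    then have "rigid (ray d c) \<subseteq> rigid (ray d' b) \<or> rigid (ray d' b) \<subseteq> rigid (ray d c)"
      using dc d'b by blast
    then have "d' = d" by (auto simp: rigid_ray_subset_iff)
    then show ?thesis using d'b by blast
  qed
  then obtain \<phi> where \<phi>: "\<And>a. \<alpha> ` rigid (ray True a) = rigid (ray d (\<phi> a))" by metis
  moreover have "\<alpha> ` rigid (ray False a) = rigid (ray (\<not> d) (\<phi> a))" for a
    using image_polar[OF rigid_subset[of "ray True a"]] by (simp add: \<phi> polar_rigid_ray)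
  ultimately have "\<alpha> ` rigid (ray e a) = rigid (ray (e = d) (\<phi> a))" for e a
    by (cases e) auto
  then show thesis by (rule that)
qed

text \<open>
  An element \<open>g\<close> conjugates the stabiliser of the half-line at \<open>x\<close> to that at \<open>g x\<close>; applying
  \<open>\<alpha>\<close> to this shows that \<open>\<phi>\<close> is equivariant. The inverse automorphism makes it onto.
\<close>

theorem induced_by_conjugation:
  obtains \<phi> :: "real \<Rightarrow> real" where "surj \<phi>"
    "strict_mono \<phi> \<or> (\<forall>x y. x < y \<longrightarrow> \<phi> y < \<phi> x)"
    "\<And>g x. g \<in> G \<Longrightarrow> \<alpha> g (\<phi> x) = \<phi> (g x)"
proof -
  obtain d \<phi> where \<phi>: "\<And>e a. \<alpha> ` rigid (ray e a) = rigid (ray (e = d) (\<phi> a))"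
    using rays_image by blast
  interpret \<beta>: automorphism G "inv_into G \<alpha>" by (rule inverse_automorphism)
  have "\<exists>a. b = \<phi> a" for b
  proof -
    obtain e a where "inv_into G \<alpha> ` rigid (ray True b) = rigid (ray e a)"
      using \<beta>.ray_image by blast
    moreover have "\<alpha> ` inv_into G \<alpha> ` rigid (ray True b) = rigid (ray True b)"
      using bijective rigid_subset by (simp add: bij_betw_def image_inv_into_cancel)
    ultimately show ?thesis using \<phi>[of e a] by auto
  qed
  then have "surj \<phi>" by (auto simp: surj_def)
  moreover have "a \<le> b \<longleftrightarrow> (if d then \<phi> a \<le> \<phi> b else \<phi> b \<le> \<phi> a)" for a b
    using image_subset_iff[OF rigid_subset rigid_subset, of "ray True a" "ray True b"]
    by (simp add: \<phi> rigid_ray_subset_iff)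
  then have "strict_mono \<phi> \<or> (\<forall>x y. x < y \<longrightarrow> \<phi> y < \<phi> x)"
    by (cases d) (auto simp: strict_mono_def not_le[symmetric])
  moreover have "\<alpha> g (\<phi> x) = \<phi> (g x)" if g: "g \<in> G" for g x
  proof -
    have "\<alpha> ` conj_set g (rigid (ray True x)) = conj_set (\<alpha> g) (rigid (ray d (\<phi> x)))"
      using image_conj_set[OF g rigid_subset] \<phi> by simp
    then show ?thesis using g by (simp add: conj_set_rigid image_ray \<phi>)
  qed
  ultimately show thesis by (rule that)
qed

end

section \<open>Germs at the ends of the line\<close>

definition has_germ :: "real filter \<Rightarrow> (real \<Rightarrow> real) \<Rightarrow> real \<Rightarrow> real \<Rightarrow> bool" where
  "has_germ F g p b \<longleftrightarrow> (\<forall>\<^sub>F x in F. g x = p * x + b)"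

definition line_end :: "real filter \<Rightarrow> bool" where
  "line_end F \<longleftrightarrow> F = at_bot \<or> F = at_top"

lemma line_end_simps [simp]: "line_end at_bot" "line_end at_top"
  by (simp_all add: line_end_def)

lemma line_end_nontrivial: "line_end F \<Longrightarrow> F \<noteq> bot"
  by (metis line_end_def trivial_limit_at_bot_linorder trivial_limit_at_top_linorder)

lemma filterlim_affine_end:
  fixes p b :: real
  assumes "line_end F" "p > 0"
  shows "filterlim (\<lambda>x. p * x + b) F F"
proof -
  have "filterlim (\<lambda>x. p * x + b) at_top at_top"
    unfolding filterlim_at_top
  proof
    fix Z
    have "Z \<le> p * x + b" if "x \<ge> (Z - b) / p" for x
      using that assms(2) by (simp add: field_simps)
    then show "\<forall>\<^sub>F x in at_top. Z \<le> p * x + b" unfolding eventually_at_top_linorder by blast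
  qed
  moreover have "filterlim (\<lambda>x. p * x + b) at_bot at_bot"
    unfolding filterlim_at_bot
  proof
    fix Z
    have "p * x + b \<le> Z" if "x \<le> (Z - b) / p" for x
      using that assms(2) by (simp add: field_simps)
    then show "\<forall>\<^sub>F x in at_bot. p * x + b \<le> Z" unfolding eventually_at_bot_linorder by blast
  qed
  ultimately show ?thesis using assms(1) by (auto simp: line_end_def)
qed

lemma affine_eventually_eq:
  fixes p b q c :: real
  assumes "line_end F" "\<forall>\<^sub>F x in F. p * x + b = q * x + c"
  shows "p = q" "b = c"
proof -
  obtain x where x: "p * x + b = q * x + c" "p * (x + 1) + b = q * (x + 1) + c"
  proof -
    from assms consider N where "\<forall>x\<ge>N. p * x + b = q * x + c" | N where "\<forall>x\<le>N. p * x + b = q * x + c"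
      by (auto simp: line_end_def eventually_at_top_linorder eventually_at_bot_linorder)
    then show thesis
    proof cases
      case (1 N)
      then show thesis using that[of N] by simp
    next
      case (2 N)
      then show thesis using that[of "N - 1"] by simp
    qed
  qed
  then show "p = q" by (simp add: algebra_simps)
  then show "b = c" using x(1) by simp
qed

lemma has_germ_unique:
  assumes "line_end F" "has_germ F g p b" "has_germ F g q c"
  shows "p = q \<and> b = c"
proof -
  have "\<forall>\<^sub>F x in F. p * x + b = q * x + c"
    using assms(2,3) unfolding has_germ_def by eventually_elim simp
  then show ?thesis using affine_eventually_eq assms(1) by blast
qed

lemma has_germ_comp:
  assumes "line_end F" "has_germ F f p b" "has_germ F g q c" "q > 0"
  shows "has_germ F (f \<circ> g) (p * q) (p * c + b)"
proof -
  have "\<forall>\<^sub>F x in F. f (q * x + c) = p * (q * x + c) + b"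
    by (rule eventually_compose_filterlim[OF assms(2)[unfolded has_germ_def]
          filterlim_affine_end[OF assms(1,4)]])
  then show ?thesis using assms(3) unfolding has_germ_def
    by eventually_elim (simp add: algebra_simps)
qed

lemma has_germ_inv:
  assumes "line_end F" "has_germ F f p b" "p > 0" "inj f"
  shows "has_germ F (inv f) (1 / p) (- b / p)"
proof -
  have "\<forall>\<^sub>F x in F. f (1 / p * x + - b / p) = p * (1 / p * x + - b / p) + b"
    by (rule eventually_compose_filterlim[OF assms(2)[unfolded has_germ_def]
          filterlim_affine_end[OF assms(1)]]) (use assms(3) in simp)
  then have "\<forall>\<^sub>F x in F. f (1 / p * x + - b / p) = x"
    by eventually_elim (use assms(3) in \<open>simp add: field_simps\<close>)
  then show ?thesis unfolding has_germ_def
    by eventually_elim (metis assms(4) inv_f_f)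
qed

lemma has_germ_funpow:
  assumes "line_end F" "has_germ F f 1 d"
  shows "has_germ F (f ^^ n) 1 (real n * d)"
proof (induction n)
  case (Suc n)
  have "has_germ F (f \<circ> (f ^^ n)) (1 * 1) (1 * (real n * d) + d)"
    by (rule has_germ_comp[OF assms Suc.IH]) simp
  then show ?case by (simp add: algebra_simps comp_def)
qed (simp add: has_germ_def)

lemma has_germ_commutator:
  assumes "line_end F" "has_germ F f p b" "has_germ F g q c" "p > 0" "q > 0" "inj f" "inj g"
  shows "has_germ F (commutator f g) 1 ((p * c + b) - (q * b + c))"
proof -
  have "has_germ F (f \<circ> g \<circ> inv f \<circ> inv g) (p * q * (1 / p) * (1 / q))
      (p * q * (1 / p) * (- c / q) + (p * q * (- b / p) + (p * c + b)))"
    using assms by (intro has_germ_comp has_germ_inv) auto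
  then show ?thesis using assms(4,5) by (simp add: commutator_def field_simps)
qed

lemma has_germ_conj:
  assumes "line_end F" "has_germ F g p b" "has_germ F t 1 d" "p > 0" "inj g"
  shows "has_germ F (g \<circ> t \<circ> inv g) 1 (p * d)"
proof -
  have "has_germ F (g \<circ> t \<circ> inv g) (p * 1 * (1 / p)) (p * 1 * (- b / p) + (p * d + b))"
    using assms by (intro has_germ_comp has_germ_inv) auto
  then show ?thesis using assms(4) by (simp add: field_simps)
qed

lemma real_eq_by_fractions:
  fixes p q :: real
  assumes "p > 0" "q > 0"
    and "\<And>m n :: nat. m > 0 \<Longrightarrow> n > 0 \<Longrightarrow> real m < real n * p \<longleftrightarrow> real m < real n * q"
  shows "p = q"
proof -
  have separate: "\<exists>m n :: nat. m > 0 \<and> n > 0 \<and> real n * a < real m \<and> real m < real n * b"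
    if "0 < a" "a < b" for a b :: real
  proof -
    obtain n where n: "real n > 1 / (b - a)" using reals_Archimedean2 by blast
    define m where "m = Suc (nat \<lfloor>real n * a\<rfloor>)"
    have gap: "real n * a + 1 < real n * b" using n that by (simp add: field_simps)
    have "n > 0" using n that by (metis divide_nonneg_pos diff_gt_0_iff_gt not_gr_zero of_nat_0 not_less zero_le_one less_imp_le of_nat_0_less_iff zero_less_divide_1_iff order_less_trans)
    moreover have "real n * a < real m" "real m \<le> real n * a + 1"
      using that unfolding m_def by (simp_all add: le_nat_iff; linarith)+
    ultimately show ?thesis using gap by (intro exI[of _ m] exI[of _ n]) (auto simp: m_def)
  qed
  show ?thesis
    using separate[of p q] separate[of q p] assms by (meson linorder_neqE_linordered_idom not_less_iff_gr_or_eq)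
qed

text \<open>
  For translation germs by \<open>d \<noteq> 0\<close> and \<open>p * d\<close>, the \<open>m\<close>-th iterate of the first lies between
  the start and the \<open>n\<close>-th iterate of the second exactly if \<open>m < n * p\<close>, and this
  description of \<open>p\<close> survives a monotone change of coordinates of either direction.
\<close>

lemma translation_ratio_invariant:
  fixes \<phi> :: "real \<Rightarrow> real"
  assumes ends: "line_end F" "line_end F'"
    and \<phi>: "strict_mono \<phi> \<or> (\<forall>x y. x < y \<longrightarrow> \<phi> y < \<phi> x)" "filterlim \<phi> F' F"
    and semiconj: "\<And>x. t' (\<phi> x) = \<phi> (t x)" "\<And>x. s' (\<phi> x) = \<phi> (s x)"
    and germs: "has_germ F t 1 d" "has_germ F s 1 (p * d)" "has_germ F' t' 1 d'" "has_germ F' s' 1 (q * d')"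
    and nz: "d \<noteq> 0" "p > 0" "q > 0"
  shows "p = q"
proof -
  define between :: "real \<Rightarrow> real \<Rightarrow> real \<Rightarrow> bool"
    where "between u v w \<longleftrightarrow> u < v \<and> v < w \<or> w < v \<and> v < u" for u v w
  have \<phi>_less: "(\<forall>x y. \<phi> x < \<phi> y \<longleftrightarrow> x < y) \<or> (\<forall>x y. \<phi> x < \<phi> y \<longleftrightarrow> y < x)"
    using \<phi>(1) strict_mono_less by (metis linorder_neqE_linordered_idom order_less_asym)
  then have between_\<phi>: "between (\<phi> u) (\<phi> v) (\<phi> w) \<longleftrightarrow> between u v w" for u v w
    by (auto simp: between_def)
  have between_iff: "between x (x + real m * e) (x + real n * (r * e)) \<longleftrightarrow> real m < real n * r"
    if "m > 0" "e \<noteq> 0" for x e r :: real and m n :: nat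
  proof -
    have "real m * e < real n * (r * e) \<longleftrightarrow> (if e > 0 then real m < real n * r else real n * r < real m)"
      using that mult_less_cancel_right[of "real m" e "real n * r"] by (auto simp: mult.assoc)
    moreover have "real n * (r * e) < real m * e \<longleftrightarrow> (if e < 0 then real m < real n * r else real n * r < real m)"
      using that mult_less_cancel_right[of "real n * r" e "real m"] by (auto simp: mult.assoc)
    moreover have "0 < real m * e \<longleftrightarrow> e > 0" "real m * e < 0 \<longleftrightarrow> e < 0"
      using that by (auto simp: zero_less_mult_iff mult_less_0_iff)
    ultimately show ?thesis using that(2) unfolding between_def
      by (cases "e > 0") auto
  qed
  have powers: "(t' ^^ m) (\<phi> x) = \<phi> ((t ^^ m) x)" "(s' ^^ m) (\<phi> x) = \<phi> ((s ^^ m) x)" for m x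
    by (induction m) (simp_all add: semiconj)
  \<comment> \<open>far out towards the end all germs hold; one such point suffices\<close>
  have sample: "\<exists>x. \<phi> (x + real m * d) = \<phi> x + real m * d' \<and>
      \<phi> (x + real n * (p * d)) = \<phi> x + real n * (q * d')" for m n
  proof -
    have "\<forall>\<^sub>F x in F. (t' ^^ m) (\<phi> x) = 1 * \<phi> x + real m * d'"
      "\<forall>\<^sub>F x in F. (s' ^^ n) (\<phi> x) = 1 * \<phi> x + real n * (q * d')"
      using eventually_compose_filterlim[OF has_germ_funpow[OF ends(2) germs(3), of m, unfolded has_germ_def] \<phi>(2)]
        eventually_compose_filterlim[OF has_germ_funpow[OF ends(2) germs(4), of n, unfolded has_germ_def] \<phi>(2)]
      by simp_all
    moreover have "\<forall>\<^sub>F x in F. (t ^^ m) x = 1 * x + real m * d"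
      "\<forall>\<^sub>F x in F. (s ^^ n) x = 1 * x + real n * (p * d)"
      using has_germ_funpow[OF ends(1) germs(1), of m] has_germ_funpow[OF ends(1) germs(2), of n]
      unfolding has_germ_def by simp_all
    ultimately have "\<forall>\<^sub>F x in F. \<phi> (x + real m * d) = \<phi> x + real m * d' \<and>
      \<phi> (x + real n * (p * d)) = \<phi> x + real n * (q * d')"
      by eventually_elim (simp add: powers)
    then show ?thesis using eventually_happens line_end_nontrivial ends(1) by blast
  qed
  have "d' \<noteq> 0"
  proof
    assume "d' = 0"
    then obtain x where "\<phi> (x + d) = \<phi> x" using sample[of 1 0] by auto
    moreover have "\<phi> (x + d) \<noteq> \<phi> x"
      using \<phi>_less nz(1) by (metis add.right_neutral add_left_cancel linorder_neqE_linordered_idom order_less_irrefl)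
    ultimately show False by simp
  qed
  show ?thesis
  proof (rule real_eq_by_fractions[OF nz(2,3)])
    fix m n :: nat assume "m > 0" "n > 0"
    obtain x where "\<phi> (x + real m * d) = \<phi> x + real m * d'"
      "\<phi> (x + real n * (p * d)) = \<phi> x + real n * (q * d')" using sample by blast
    then show "real m < real n * p \<longleftrightarrow> real m < real n * q"
      using between_iff[of m d x n p] between_iff[of m d' "\<phi> x" n q] \<open>m > 0\<close> nz(1) \<open>d' \<noteq> 0\<close>
        between_\<phi>[of x "x + real m * d" "x + real n * (p * d)"] by simp
  qed
qed

text \<open>
  A commutator of elements with noncommuting affine germs is a nonzero translation near the
  end, and conjugation by \<open>g\<close> scales it by the slope of \<open>g\<close>. The image of this commutator
  under \<open>\<alpha>\<close> is again a commutator, hence again a translation near the image end.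
\<close>

lemma (in automorphism) end_slope_invariant:
  assumes ends: "line_end F" "line_end F'"
    and germ: "\<And>E g. line_end E \<Longrightarrow> g \<in> G \<Longrightarrow> \<exists>p b. p > 0 \<and> has_germ E g p b"
    and \<phi>: "strict_mono \<phi> \<or> (\<forall>x y. x < y \<longrightarrow> \<phi> y < \<phi> x)" "filterlim \<phi> F' F"
      "\<And>g x. g \<in> G \<Longrightarrow> \<alpha> g (\<phi> x) = \<phi> (g x)"
    and nonabelian: "\<exists>f\<in>G. \<exists>g\<in>G. \<exists>p b q c. has_germ F f p b \<and> has_germ F g q c \<and> p * c + b \<noteq> q * b + c"
    and g: "g \<in> G" "has_germ F g p b" "has_germ F' (\<alpha> g) q c"
  shows "p = q"
proof -
  have pos: "0 < p" if "line_end E" "g \<in> G" "has_germ E g p b" for E g p b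
    using germ[OF that(1,2)] has_germ_unique[OF that(1) _ that(3)] by blast
  have gpos: "0 < p" "0 < q" using pos[OF ends(1) g(1,2)] pos[OF ends(2) _ g(3)] g(1) by simp_all
  obtain f h p1 b1 p2 b2 where fh: "f \<in> G" "h \<in> G" "has_germ F f p1 b1" "has_germ F h p2 b2"
      "p1 * b2 + b1 \<noteq> p2 * b1 + b2" using nonabelian by blast
  define t where "t = commutator f h"
  define d where "d = (p1 * b2 + b1) - (p2 * b1 + b2)"
  have tG: "t \<in> G" unfolding t_def using fh by (intro commutator_in)
  have t: "has_germ F t 1 d" unfolding t_def d_def
    by (rule has_germ_commutator[OF ends(1) fh(3,4) pos[OF ends(1) fh(1,3)] pos[OF ends(1) fh(2,4)]
          inj[OF fh(1)] inj[OF fh(2)]])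
  have images: "\<alpha> f \<in> G" "\<alpha> h \<in> G" "\<alpha> g \<in> G" using fh(1,2) g(1) by simp_all
  obtain q1 c1 where 1: "q1 > 0" "has_germ F' (\<alpha> f) q1 c1" using germ[OF ends(2) images(1)] by blast
  obtain q2 c2 where 2: "q2 > 0" "has_germ F' (\<alpha> h) q2 c2" using germ[OF ends(2) images(2)] by blast
  have "has_germ F' (commutator (\<alpha> f) (\<alpha> h)) 1 ((q1 * c2 + c1) - (q2 * c1 + c2))"
    by (rule has_germ_commutator[OF ends(2) 1(2) 2(2) 1(1) 2(1) inj[OF images(1)] inj[OF images(2)]])
  then obtain d' where t': "has_germ F' (\<alpha> t) 1 d'" by (auto simp: t_def map_commutator fh)
  have s: "has_germ F (g \<circ> t \<circ> inv g) 1 (p * d)"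
    by (rule has_germ_conj[OF ends(1) g(2) t gpos(1) inj[OF g(1)]])
  have "has_germ F' (\<alpha> g \<circ> \<alpha> t \<circ> inv (\<alpha> g)) 1 (q * d')"
    by (rule has_germ_conj[OF ends(2) g(3) t' gpos(2) inj[OF images(3)]])
  then have s': "has_germ F' (\<alpha> (g \<circ> t \<circ> inv g)) 1 (q * d')"
    using g tG by (simp add: hom map_inv comp inverse)
  have conj: "g \<circ> t \<circ> inv g \<in> G" using g tG by (intro comp inverse)
  have "d \<noteq> 0" using fh(5) by (simp add: d_def)
  then show ?thesis
    by (rule translation_ratio_invariant[OF ends \<phi>(1,2) \<phi>(3)[OF tG] \<phi>(3)[OF conj] t s t' s' _ gpos])
qed

lemma filterlim_increasing_surj:
  fixes \<phi> :: "real \<Rightarrow> real"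
  assumes "strict_mono \<phi>" "surj \<phi>"
  shows "filterlim \<phi> at_top at_top" "filterlim \<phi> at_bot at_bot"
  unfolding filterlim_at_top filterlim_at_bot eventually_at_top_linorder eventually_at_bot_linorder
  using assms by (metis strict_mono_less_eq surjD)+

lemma filterlim_decreasing_surj:
  fixes \<phi> :: "real \<Rightarrow> real"
  assumes "\<And>x y. x < y \<Longrightarrow> \<phi> y < \<phi> x" "surj \<phi>"
  shows "filterlim \<phi> at_top at_bot" "filterlim \<phi> at_bot at_top"
  unfolding filterlim_at_top filterlim_at_bot eventually_at_top_linorder eventually_at_bot_linorder
  using assms by (metis order_le_less surjD order_refl)+

section \<open>One-sided slopes of piecewise linear maps\<close>

definition left_slope :: "(real \<Rightarrow> real) \<Rightarrow> real \<Rightarrow> real \<Rightarrow> bool" where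
  "left_slope g x l \<longleftrightarrow> (\<forall>\<^sub>F z in at_left x. g z = g x + l * (z - x))"

definition right_slope :: "(real \<Rightarrow> real) \<Rightarrow> real \<Rightarrow> real \<Rightarrow> bool" where
  "right_slope g x r \<longleftrightarrow> (\<forall>\<^sub>F z in at_right x. g z = g x + r * (z - x))"

lemma has_derivative_of_eventually_affine:
  fixes g :: "real \<Rightarrow> real"
  assumes "\<forall>\<^sub>F z in at x within S. g z = g x + l * (z - x)"
  shows "(g has_real_derivative l) (at x within S)"
proof -
  have "((\<lambda>z. g x + l * (z - x)) has_real_derivative l) (at x within S)"
    by (auto intro!: derivative_eq_intros)
  then show ?thesis
    using has_field_derivative_cong_eventually[OF assms] by simp
qed

lemma one_sided_derivative_unique:
  fixes g :: "real \<Rightarrow> real"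
  assumes "(g has_real_derivative a) (at x within S)" "(g has_real_derivative b) (at x within S)"
    "at x within S \<noteq> bot"
  shows "a = b"
  using assms unfolding has_field_derivative_iff by (blast intro: tendsto_unique)

lemma left_slope_derivative: "left_slope g x l \<Longrightarrow> (g has_real_derivative l) (at_left x)"
  unfolding left_slope_def by (rule has_derivative_of_eventually_affine)

lemma right_slope_derivative: "right_slope g x r \<Longrightarrow> (g has_real_derivative r) (at_right x)"
  unfolding right_slope_def by (rule has_derivative_of_eventually_affine)

lemma break_point_iff:
  assumes "left_slope g x l" "right_slope g x r"
  shows "x \<in> break_points g \<longleftrightarrow> l \<noteq> r"
proof
  assume "x \<in> break_points g"
  then obtain l' r' where "(g has_real_derivative l') (at_left x)"
      "(g has_real_derivative r') (at_right x)" "l' \<noteq> r'" by (auto simp: break_points_def)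
  then show "l \<noteq> r"
    using one_sided_derivative_unique[OF left_slope_derivative[OF assms(1)], of l']
      one_sided_derivative_unique[OF right_slope_derivative[OF assms(2)], of r'] by simp
next
  assume "l \<noteq> r"
  then show "x \<in> break_points g"
    using left_slope_derivative[OF assms(1)] right_slope_derivative[OF assms(2)]
    by (auto simp: break_points_def)
qed

lemma derivative_eq_left_slope:
  assumes "(g has_real_derivative p) (at x)" "left_slope g x l"
  shows "p = l"
  using one_sided_derivative_unique[OF has_field_derivative_at_within[OF assms(1)]
      left_slope_derivative[OF assms(2)]] by simp

lemma locally_affine_of_slopes:
  assumes "left_slope g x l" "right_slope g x l"
  shows "\<forall>\<^sub>F z in nhds x. g z = g x + l * (z - x)"
  using assms unfolding left_slope_def right_slope_def
  by (simp add: eventually_nhds_conv_at eventually_at_split)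

lemma finite_gap_left:
  fixes x :: real
  assumes "finite (S \<inter> {x - 1..x + 1})"
  shows "\<exists>u<x. {u<..<x} \<inter> S = {}"
proof -
  \<comment> \<open>inserting \<open>x - 1\<close> makes the maximum exist when no point of \<open>S\<close> is near\<close>
  define T where "T = insert (x - 1) (S \<inter> {x - 1..<x})"
  have fin: "finite T" unfolding T_def
    by (simp, rule finite_subset[OF _ assms]) auto
  have "Max T \<in> T" by (rule Max_in[OF fin]) (auto simp: T_def)
  moreover have "{Max T<..<x} \<inter> S = {}"
  proof -
    have "False" if "z \<in> S" "Max T < z" "z < x" for z
    proof -
      have "x - 1 \<le> Max T" by (rule Max_ge[OF fin]) (simp add: T_def)
      then have "z \<in> T" using that by (simp add: T_def)
      then show False using Max_ge[OF fin] that by force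
    qed
    then show ?thesis by auto
  qed
  ultimately show ?thesis by (intro exI[of _ "Max T"]) (auto simp: T_def)
qed

lemma finite_gap_right:
  fixes x :: real
  assumes "finite (S \<inter> {x - 1..x + 1})"
  shows "\<exists>v>x. {x<..<v} \<inter> S = {}"
proof -
  have "(uminus ` S) \<inter> {- x - 1..- x + 1} = uminus ` (S \<inter> {x - 1..x + 1})" by (auto simp: image_iff) 
  then obtain u where "u < - x" "{u<..<- x} \<inter> uminus ` S = {}"
    using finite_gap_left[of "uminus ` S" "- x"] assms by auto
  then show ?thesis by (intro exI[of _ "- u"]) (force simp: image_iff)
qed

lemma affine_near_left:
  assumes "isCont g x" "affine_map f" "u < x" "\<forall>z\<in>{u<..<x}. g z = f z"
  shows "\<exists>l. left_slope g x l"
proof -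
  obtain p b where f: "f = (\<lambda>x. p * x + b)" using assms(2) by (auto simp: affine_map_def)
  have ev: "\<forall>\<^sub>F z in at_left x. g z = p * z + b"
    using eventually_at_left_real[OF assms(3)] by eventually_elim (use assms(4) f in auto)
  have "((\<lambda>z. p * z + b) \<longlongrightarrow> p * x + b) (at_left x)" by (intro tendsto_intros)
  then have "(g \<longlongrightarrow> p * x + b) (at_left x)" using tendsto_cong[OF ev] by simp
  moreover have "(g \<longlongrightarrow> g x) (at_left x)"
    using assms(1) by (simp add: isCont_def filterlim_at_split)
  ultimately have "g x = p * x + b" using tendsto_unique trivial_limit_at_left_real by blast
  then have "left_slope g x p"
    using ev unfolding left_slope_def by (auto elim!: eventually_mono simp: algebra_simps)
  then show ?thesis by blast
qed

lemma affine_near_right: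
  assumes "isCont g x" "affine_map f" "x < v" "\<forall>z\<in>{x<..<v}. g z = f z"
  shows "\<exists>r. right_slope g x r"
proof -
  obtain p b where f: "f = (\<lambda>x. p * x + b)" using assms(2) by (auto simp: affine_map_def)
  have ev: "\<forall>\<^sub>F z in at_right x. g z = p * z + b"
    using eventually_at_right_real[OF assms(3)] by eventually_elim (use assms(4) f in auto)
  have "((\<lambda>z. p * z + b) \<longlongrightarrow> p * x + b) (at_right x)" by (intro tendsto_intros)
  then have "(g \<longlongrightarrow> p * x + b) (at_right x)" using tendsto_cong[OF ev] by simp
  moreover have "(g \<longlongrightarrow> g x) (at_right x)"
    using assms(1) by (simp add: isCont_def filterlim_at_split)
  ultimately have "g x = p * x + b" using tendsto_unique trivial_limit_at_right_real by blast
  then have "right_slope g x p"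
    using ev unfolding right_slope_def by (auto elim!: eventually_mono simp: algebra_simps)
  then show ?thesis by blast
qed

lemma PLo_surj: "g \<in> PLo \<Longrightarrow> surj g"
  by (auto simp: PLo_def homeomorphism_def)

lemma PLo_strict_mono: "g \<in> PLo \<Longrightarrow> strict_mono g"
  by (auto simp: PLo_def)

lemma PLo_isCont: "g \<in> PLo \<Longrightarrow> isCont g x"
  by (auto simp: PLo_def homeomorphism_def continuous_on_eq_continuous_at)

lemma PLo_slopes_exist:
  assumes "g \<in> PLo"
  shows "\<exists>l. left_slope g x l" "\<exists>r. right_slope g x r"
proof -
  obtain S where S: "\<And>u v. finite (S \<inter> {u..v})"
      "\<And>u v. {u<..<v} \<inter> S = {} \<Longrightarrow> \<exists>f. affine_map f \<and> (\<forall>x\<in>{u<..<v}. g x = f x)"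
    using assms by (auto simp: PLo_def piecewise_linear_def)
  show "\<exists>l. left_slope g x l"
    using finite_gap_left[OF S(1)] S(2) affine_near_left PLo_isCont[OF assms] by metis
  show "\<exists>r. right_slope g x r"
    using finite_gap_right[OF S(1)] S(2) affine_near_right PLo_isCont[OF assms] by metis
qed

lemma slope_in_slopes:
  shows "left_slope g x l \<Longrightarrow> l \<in> slopes g" "right_slope g x l \<Longrightarrow> l \<in> slopes g"
proof -
  have inner: "l \<in> slopes g" if "u < v" "\<And>z. u < z \<Longrightarrow> z < v \<Longrightarrow> g z = g x + l * (z - x)" for u v
  proof -
    \<comment> \<open>at an interior point of an affine piece the two-sided derivative is \<open>l\<close>\<close>
    define y where "y = (u + v) / 2"
    have y: "y \<in> {u<..<v}" using that by (auto simp: y_def)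
    have "\<forall>\<^sub>F z in at y. z \<in> {u<..<v}"
      using y by (intro eventually_at_in_open') auto
    then have "\<forall>\<^sub>F z in at y. g z = g y + l * (z - y)"
    proof eventually_elim
      case (elim z)
      then have "g z = g x + l * (z - x)" using that(2) by simp
      moreover have "g y = g x + l * (y - x)" using that(2) y by simp
      ultimately show ?case by (simp add: algebra_simps)
    qed
    then show ?thesis unfolding slopes_def using has_derivative_of_eventually_affine by blast
  qed
  show "l \<in> slopes g" if slope: "left_slope g x l"
  proof -
    obtain u where "u < x" "\<forall>z>u. z < x \<longrightarrow> g z = g x + l * (z - x)"
      using slope unfolding left_slope_def eventually_at_left_field by blast
    then show ?thesis by (intro inner[of u x]) auto
  qed
  show "l \<in> slopes g" if slope: "right_slope g x l"
  proof -
    obtain v where "x < v" "\<forall>z>x. z < v \<longrightarrow> g z = g x + l * (z - x)"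
      using slope unfolding right_slope_def eventually_at_right_field by blast
    then show ?thesis by (intro inner[of x v]) auto
  qed
qed

text \<open>
  The local slope is a locally constant function, hence constant on a connected set.
\<close>

lemma affine_on_interval:
  fixes g :: "real \<Rightarrow> real"
  assumes "open I" "convex I"
    and local: "\<And>x. x \<in> I \<Longrightarrow> \<exists>l. \<forall>\<^sub>F z in nhds x. g z = g x + l * (z - x)"
  shows "\<exists>p b. \<forall>x\<in>I. g x = p * x + b"
proof -
  obtain s where s: "\<And>x. x \<in> I \<Longrightarrow> \<forall>\<^sub>F z in nhds x. g z = g x + s x * (z - x)"
    using local by metis
  have der: "(g has_real_derivative s x) (at x)" if "x \<in> I" for x
    using s[OF that] by (intro has_derivative_of_eventually_affine) (auto simp: eventually_nhds_conv_at)
  have "\<exists>T. openin (top_of_set I) T \<and> a \<in> T \<and> (\<forall>x\<in>T. s x = s a)" if a: "a \<in> I" for a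
  proof -
    obtain T where T: "open T" "a \<in> T" "\<And>z. z \<in> T \<Longrightarrow> g z = g a + s a * (z - a)"
      using s[OF a] unfolding eventually_nhds by blast
    have "s x = s a" if x: "x \<in> T \<inter> I" for x
    proof -
      have "\<forall>\<^sub>F z in at x. z \<in> T" using x T(1) by (intro eventually_at_in_open') auto
      then have "\<forall>\<^sub>F z in at x. g z = g x + s a * (z - x)"
      proof eventually_elim
        case (elim z)
        moreover have "g x = g a + s a * (x - a)" using T(3) x by simp
        ultimately show ?case using T(3)[of z] by (simp add: algebra_simps)
      qed
      then have "(g has_real_derivative s a) (at x)" by (rule has_derivative_of_eventually_affine)
      then show ?thesis using der x DERIV_unique by blast
    qed
    then show ?thesis using openin_open_Int[OF T(1), of I] T(2) a by blast
  qed
  then have "s constant_on I"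
    using assms(2) by (intro locally_constant_imp_constant convex_connected)
  then obtain p where p: "\<And>x. x \<in> I \<Longrightarrow> s x = p" by (auto simp: constant_on_def)
  have "\<exists>c. \<forall>x\<in>I. g x - p * x = c"
  proof (rule has_field_derivative_zero_constant[OF assms(2)])
    fix x assume x: "x \<in> I"
    have "((\<lambda>x. g x - p * x) has_real_derivative p - p) (at x)"
      using der[OF x] p[OF x] by (auto intro!: derivative_eq_intros)
    then show "((\<lambda>x. g x - p * x) has_real_derivative 0) (at x within I)"
      by (simp add: has_field_derivative_at_within)
  qed
  then obtain c where c: "\<And>x. x \<in> I \<Longrightarrow> g x - p * x = c" by blast
  have "g x = p * x + c" if "x \<in> I" for x using c[OF that] by simp
  then show ?thesis by blast
qed

lemma PLo_affine_between_breaks: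
  assumes "g \<in> PLo" "open I" "convex I" "I \<inter> break_points g = {}"
  shows "\<exists>p b. \<forall>x\<in>I. g x = p * x + b"
proof (rule affine_on_interval[OF assms(2,3)])
  fix x assume x: "x \<in> I"
  obtain l r where lr: "left_slope g x l" "right_slope g x r" using PLo_slopes_exist[OF assms(1)] by blast
  then have "l = r" using break_point_iff[OF lr] x assms(4) by blast
  then show "\<exists>l. \<forall>\<^sub>F z in nhds x. g z = g x + l * (z - x)" using locally_affine_of_slopes lr by blast
qed

text \<open>
  The subdivision in the definition of a piecewise linear map may be infinite; only the
  finiteness of the set of break points makes the map affine near the ends.
\<close>

lemma PLo_has_germ:
  assumes "g \<in> PLo" "line_end F"
  shows "\<exists>p b. has_germ F g p b"
proof -
  have "finite (break_points g)" using assms(1) by (simp add: PLo_def)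
  then obtain M where M: "\<forall>x\<in>break_points g. \<bar>x\<bar> \<le> M"
    by (meson finite_imp_bounded bounded_real)
  from assms(2) have "(F = at_bot) \<or> (F = at_top)" by (simp add: line_end_def)
  then show ?thesis
  proof
    assume F: "F = at_bot"
    obtain p b where "\<forall>x\<in>{..<- M}. g x = p * x + b"
      using PLo_affine_between_breaks[OF assms(1), of "{..<- M}"] M by force
    then have "has_germ F g p b" unfolding has_germ_def F eventually_at_bot_dense by auto
    then show ?thesis by blast
  next
    assume F: "F = at_top"
    obtain p b where "\<forall>x\<in>{M<..}. g x = p * x + b"
      using PLo_affine_between_breaks[OF assms(1), of "{M<..}"] M by force
    then have "has_germ F g p b" unfolding has_germ_def F eventually_at_top_dense by auto
    then show ?thesis by blast
  qed
qed

lemma has_germ_eventually_derivative: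
  assumes "line_end F" "has_germ F g p b"
  shows "\<forall>\<^sub>F x in F. (g has_real_derivative p) (at x)"
proof -
  have aff: "(g has_real_derivative p) (at x)" if "open I" "x \<in> I" "\<And>z. z \<in> I \<Longrightarrow> g z = p * z + b" for I x
  proof -
    have "\<forall>\<^sub>F z in at x. z \<in> I" using that by (intro eventually_at_in_open') auto
    then have "\<forall>\<^sub>F z in at x. g z = g x + p * (z - x)"
      by eventually_elim (use that in \<open>simp add: algebra_simps\<close>)
    then show ?thesis by (rule has_derivative_of_eventually_affine)
  qed
  from assms(1) have "(F = at_bot) \<or> (F = at_top)" by (simp add: line_end_def)
  then show ?thesis
  proof
    assume F: "F = at_bot"
    obtain N where "\<And>x. x < N \<Longrightarrow> g x = p * x + b"
      using assms(2) unfolding has_germ_def F eventually_at_bot_dense by blast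
    then show ?thesis unfolding F eventually_at_bot_dense using aff[of "{..<N}"] by auto
  next
    assume F: "F = at_top"
    obtain N where "\<And>x. x > N \<Longrightarrow> g x = p * x + b"
      using assms(2) unfolding has_germ_def F eventually_at_top_dense by blast
    then show ?thesis unfolding F eventually_at_top_dense using aff[of "{N<..}"] by auto
  qed
qed

lemma has_germ_in_slopes:
  assumes "line_end F" "has_germ F g p b"
  shows "p \<in> slopes g"
  using eventually_happens[OF has_germ_eventually_derivative[OF assms]] line_end_nontrivial[OF assms(1)]
  by (auto simp: slopes_def)

lemma the_end_slope:
  assumes "line_end F" "has_germ F g p b"
  shows "(THE p. \<forall>\<^sub>F x in F. (g has_real_derivative p) (at x)) = p"
proof (rule the_equality)
  show ev: "\<forall>\<^sub>F x in F. (g has_real_derivative p) (at x)" using has_germ_eventually_derivative[OF assms] .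
  fix q assume "\<forall>\<^sub>F x in F. (g has_real_derivative q) (at x)"
  with ev have "\<forall>\<^sub>F x in F. q = p" by eventually_elim (rule DERIV_unique)
  then show "q = p" using line_end_nontrivial[OF assms(1)] by simp
qed

lemma the_end_germ:
  assumes "line_end F" "has_germ F g p b"
  shows "(THE f. affine_map f \<and> (\<forall>\<^sub>F x in F. g x = f x)) = (\<lambda>x. p * x + b)"
proof (rule the_equality)
  show "affine_map (\<lambda>x. p * x + b) \<and> (\<forall>\<^sub>F x in F. g x = p * x + b)"
    using assms(2) by (auto simp: affine_map_def has_germ_def)
  fix f assume f: "affine_map f \<and> (\<forall>\<^sub>F x in F. g x = f x)"
  then obtain q c where "f = (\<lambda>x. q * x + c)" by (auto simp: affine_map_def)
  then show "f = (\<lambda>x. p * x + b)" using f has_germ_unique[OF assms, of q c] by (simp add: has_germ_def)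
qed

lemma left_slope_inv:
  assumes "strict_mono g" "surj g" "left_slope g x l" "l > 0"
  shows "left_slope (inv g) (g x) (1 / l)"
proof -
  have inj: "inj g" using assms(1) by (simp add: strict_mono_on_imp_inj_on)
  obtain u where u: "u < x" "\<And>z. u < z \<Longrightarrow> z < x \<Longrightarrow> g z = g x + l * (z - x)"
    using assms(3) unfolding left_slope_def eventually_at_left_field by blast
  have "inv g w = x + 1 / l * (w - g x)" if "g u < w" "w < g x" for w
  proof -
    obtain z where z: "w = g z" using assms(2) by (metis surjD)
    then have "u < z" "z < x" using that strict_mono_less[OF assms(1)] by auto
    then show ?thesis using u(2)[of z] z assms(4) inj by (simp add: field_simps)
  qed
  moreover have "g u < g x" using u(1) assms(1) by (simp add: strict_mono_less)
  ultimately show ?thesis unfolding left_slope_def eventually_at_left_field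
    using inj by auto
qed

lemma right_slope_inv:
  assumes "strict_mono g" "surj g" "right_slope g x l" "l > 0"
  shows "right_slope (inv g) (g x) (1 / l)"
proof -
  have inj: "inj g" using assms(1) by (simp add: strict_mono_on_imp_inj_on)
  obtain v where v: "v > x" "\<And>z. x < z \<Longrightarrow> z < v \<Longrightarrow> g z = g x + l * (z - x)"
    using assms(3) unfolding right_slope_def eventually_at_right_field by blast
  have "inv g w = x + 1 / l * (w - g x)" if "g x < w" "w < g v" for w
  proof -
    obtain z where z: "w = g z" using assms(2) by (metis surjD)
    then have "x < z" "z < v" using that strict_mono_less[OF assms(1)] by auto
    then show ?thesis using v(2)[of z] z assms(4) inj by (simp add: field_simps)
  qed
  moreover have "g x < g v" using v(1) assms(1) by (simp add: strict_mono_less)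
  ultimately show ?thesis unfolding right_slope_def eventually_at_right_field
    using inj by auto
qed

lemma piecewise_linear_inv:
  assumes "strict_mono g" "surj g" "piecewise_linear g"
  shows "piecewise_linear (inv g)"
proof -
  have inj: "inj g" using assms(1) by (simp add: strict_mono_on_imp_inj_on)
  have gi: "g (inv g y) = y" for y using assms(2) by (simp add: surj_f_inv_f)
  have less: "g x < g y \<longleftrightarrow> x < y" "g x \<le> g y \<longleftrightarrow> x \<le> y" for x y
    using assms(1) by (simp_all add: strict_mono_less strict_mono_less_eq)
  obtain S where S: "\<And>u v. finite (S \<inter> {u..v})"
      "\<And>u v. {u<..<v} \<inter> S = {} \<Longrightarrow> \<exists>f. affine_map f \<and> (\<forall>x\<in>{u<..<v}. g x = f x)"
    using assms(3) by (auto simp: piecewise_linear_def)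
  have "finite (g ` S \<inter> {u..v})" for u v
  proof (rule finite_subset)
    show "g ` S \<inter> {u..v} \<subseteq> g ` (S \<inter> {inv g u..inv g v})"
    proof
      fix y assume "y \<in> g ` S \<inter> {u..v}"
      then obtain x where x: "x \<in> S" "y = g x" "u \<le> g x" "g x \<le> v" by auto
      have "inv g u \<le> x" "x \<le> inv g v"
        using x less(2)[of "inv g u" x] less(2)[of x "inv g v"] by (simp_all add: gi)
      then show "y \<in> g ` (S \<inter> {inv g u..inv g v})" using x by simp
    qed
    show "finite (g ` (S \<inter> {inv g u..inv g v}))" using S(1) by simp
  qed
  moreover have "\<exists>f. affine_map f \<and> (\<forall>y\<in>{u<..<v}. inv g y = f y)"
    if gap: "{u<..<v} \<inter> g ` S = {}" for u v
  proof (cases "u < v")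
    case True
    have mem: "inv g y \<in> {inv g u<..<inv g v}" if "y \<in> {u<..<v}" for y
      using that less(1)[of "inv g u" "inv g y"] less(1)[of "inv g y" "inv g v"] by (simp add: gi)
    have "{inv g u<..<inv g v} \<inter> S = {}"
    proof -
      have "g x \<in> {u<..<v}" if "x \<in> {inv g u<..<inv g v}" for x
        using that less(1)[of "inv g u" x] less(1)[of x "inv g v"] by (simp add: gi)
      then show ?thesis using gap by blast
    qed
    then obtain p b where pb: "\<And>x. x \<in> {inv g u<..<inv g v} \<Longrightarrow> g x = p * x + b"
      using S(2) by (metis affine_map_def)
    have val: "y = p * inv g y + b" if "y \<in> {u<..<v}" for y
      using pb[OF mem[OF that]] by (simp add: gi)
    have "p \<noteq> 0"
    proof
      assume "p = 0"
      then have "(u + v) / 2 = b" "(2 * u + v) / 3 = b"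
        using val[of "(u + v) / 2"] val[of "(2 * u + v) / 3"] True by auto
      then show False using True by (simp add: field_simps)
    qed
    then have "inv g y = 1 / p * y + - b / p" if "y \<in> {u<..<v}" for y
      using val[OF that] by (simp add: field_simps)
    then show ?thesis by (intro exI[of _ "\<lambda>y. 1 / p * y + - b / p"]) (unfold affine_map_def, blast)
  next
    case False
    have "affine_map (\<lambda>y. 1 * y + 0)" unfolding affine_map_def by blast
    then show ?thesis using False by auto
  qed
  ultimately show ?thesis unfolding piecewise_linear_def by (intro exI[of _ "g ` S"]) blast
qed

text \<open>
  At every point the derivative, if it exists, is the left slope, so it suffices to control
  the one-sided slopes; break points are the points where they differ.
\<close>

lemma PL_intro:
  assumes "strict_mono g" "surj g" "piecewise_linear g"
    and slopes: "\<And>x. \<exists>l\<in>P. left_slope g x l" "\<And>x. \<exists>r\<in>P. right_slope g x r"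
    and T: "finite T" "T \<subseteq> A" "\<And>x. x \<notin> T \<Longrightarrow> \<exists>l. left_slope g x l \<and> right_slope g x l"
    and "g ` A = A"
  shows "g \<in> PL A P"
proof -
  have "break_points g \<subseteq> T" using T(3) break_point_iff by blast
  moreover have "slopes g \<subseteq> P"
    using slopes(1) derivative_eq_left_slope by (fastforce simp: slopes_def)
  ultimately show ?thesis
    using assms homeomorphism_of_strict_mono_surj[OF assms(1,2)] finite_subset[of "break_points g" T]
    by (auto simp: PL_def PLo_def)
qed

section \<open>Elements with small support\<close>

text \<open>
  Slope \<open>p\<close> on an interval of length \<open>s\<close>, followed by slope \<open>1 / p\<close> on an interval of length
  \<open>p * s\<close>: what is gained on the first is lost on the second, so the graph returns to the
  diagonal at \<open>a + s + p * s\<close>. All break points and their images are in \<open>A\<close> if \<open>a\<close> and \<open>s\<close>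
  are.
\<close>

definition bump :: "real \<Rightarrow> real \<Rightarrow> real \<Rightarrow> real \<Rightarrow> real" where
  "bump a s p x =
    (if x \<le> a then x
     else if x \<le> a + s then a + p * (x - a)
     else if x \<le> a + s + p * s then a + p * s + (x - a - s) / p
     else x)"

context
  fixes a s p :: real
  assumes s: "s > 0" and p: "p > 0"
begin

lemma bump_pieces:
  "x \<le> a \<Longrightarrow> bump a s p x = x"
  "a \<le> x \<Longrightarrow> x \<le> a + s \<Longrightarrow> bump a s p x = a + p * (x - a)"
  "a + s \<le> x \<Longrightarrow> x \<le> a + s + p * s \<Longrightarrow> bump a s p x = a + p * s + (x - a - s) / p"
  "a + s + p * s \<le> x \<Longrightarrow> bump a s p x = x"
proof -
  have ps: "p * s > 0" using s p by simp
  show "x \<le> a \<Longrightarrow> bump a s p x = x" by (simp add: bump_def)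
  show "a \<le> x \<Longrightarrow> x \<le> a + s \<Longrightarrow> bump a s p x = a + p * (x - a)"
    by (auto simp: bump_def)
  show "a + s \<le> x \<Longrightarrow> x \<le> a + s + p * s \<Longrightarrow> bump a s p x = a + p * s + (x - a - s) / p"
    using s by (cases "x = a + s") (auto simp: bump_def)
  show "a + s + p * s \<le> x \<Longrightarrow> bump a s p x = x"
  proof -
    assume x: "a + s + p * s \<le> x"
    then have "\<not> x \<le> a" "\<not> x \<le> a + s" using s ps by linarith+
    then show ?thesis using x p by (cases "x = a + s + p * s") (simp_all add: bump_def)
  qed
qed

lemma bump_ranges:
  "a \<le> x \<Longrightarrow> x \<le> a + s \<Longrightarrow> a \<le> bump a s p x \<and> bump a s p x \<le> a + p * s"
  "a + s \<le> x \<Longrightarrow> x \<le> a + s + p * s \<Longrightarrow> a + p * s \<le> bump a s p x \<and> bump a s p x \<le> a + s + p * s"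
proof -
  show "a \<le> x \<Longrightarrow> x \<le> a + s \<Longrightarrow> a \<le> bump a s p x \<and> bump a s p x \<le> a + p * s"
    using p mult_left_mono[of "x - a" s p] by (simp add: bump_pieces)
  show "a + s \<le> x \<Longrightarrow> x \<le> a + s + p * s \<Longrightarrow> a + p * s \<le> bump a s p x \<and> bump a s p x \<le> a + s + p * s"
    using p by (simp add: bump_pieces pos_divide_le_eq mult.commute)
qed

text \<open>
  The inverse has slope \<open>1 / p\<close> first, on an interval of length \<open>p * s\<close>, and is therefore a
  bump again.
\<close>

lemma bump_inverse: "bump a (p * s) (1 / p) (bump a s p x) = x"
proof -
  have ps: "p * s > 0" using s p by simp
  consider "x \<le> a" | "a \<le> x" "x \<le> a + s" | "a + s \<le> x" "x \<le> a + s + p * s" | "a + s + p * s \<le> x"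
    by linarith
  then show ?thesis
  proof cases
    case 2
    show ?thesis
    proof (cases "x = a")
      case False
      have "p * (x - a) > 0" "p * (x - a) \<le> p * s" using False 2 p by simp_all
      then show ?thesis using 2 p by (simp add: bump_pieces(2)) (simp add: bump_def)
    qed (simp add: bump_def)
  next
    case 3
    have e: "1 / p * (p * s) = s" using p by simp
    show ?thesis
    proof (cases "x = a + s")
      case True
      then show ?thesis using s p ps by (simp add: bump_def mult_le_0_iff)
    next
      case False
      then have "(x - a - s) / p > 0" "(x - a - s) / p \<le> s"
        using 3 p by (simp_all add: pos_divide_le_eq mult.commute)
      then show ?thesis using 3 p ps by (simp add: bump_pieces(3)) (simp add: bump_def e)
    qed
  next
    case 4
    have e: "1 / p * (p * s) = s" using p by simp
    have "\<not> x \<le> a" "\<not> x \<le> a + p * s" using 4 s ps by linarith+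
    then have "bump a (p * s) (1 / p) x = x"
      using 4 p by (cases "x = a + s + p * s") (simp_all add: bump_def e)
    then show ?thesis using 4 by (simp add: bump_pieces(4))
  qed (simp add: bump_def)
qed

lemma bump_strict_mono: "strict_mono (bump a s p)"
proof (rule strict_monoI)
  have ps: "p * s > 0" using s p by simp
  have inj: "bump a s p x \<noteq> bump a s p y" if "x \<noteq> y" for x y
    using bump_inverse that by metis
  fix x y :: real assume xy: "x < y"
  have "bump a s p x \<le> bump a s p y"
  proof -
    have mono: "p * (x - a) \<le> p * (y - a)" "(x - a - s) / p \<le> (y - a - s) / p"
      using xy p by (simp_all add: divide_right_mono)
    consider "y \<le> a" | "a \<le> y" "y \<le> a + s" | "a + s \<le> y" "y \<le> a + s + p * s" | "a + s + p * s \<le> y"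
      by linarith
    then show ?thesis
    proof cases
      case 1
      then show ?thesis using xy by (simp add: bump_pieces(1))
    next
      case 2
      then show ?thesis using xy mono bump_ranges(1)[of y] bump_pieces(1,2)[of x] bump_pieces(2)[of y]
        by (cases "x \<le> a") simp_all
    next
      case 3
      consider (out) "x \<le> a" | (left) "a \<le> x" "x \<le> a + s" | (right) "a + s \<le> x" by linarith
      then show ?thesis
      proof cases
        case out
        then show ?thesis using bump_pieces(1)[of x] bump_ranges(2)[of y] 3 ps by linarith
      next
        case left
        then show ?thesis using bump_ranges(1)[of x] bump_ranges(2)[of y] 3 by linarith
      next
        case right
        then show ?thesis using bump_pieces(3)[of x] bump_pieces(3)[of y] 3 mono xy by linarith
      qed
    next
      case 4
      consider "x \<le> a" | "a \<le> x" "x \<le> a + s" | "a + s \<le> x" "x \<le> a + s + p * s" | "a + s + p * s \<le> x"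
        by linarith
      then show ?thesis
        using bump_pieces(1,4)[of x] bump_pieces(4)[of y] bump_ranges[of x] 4 xy s ps by cases linarith+
    qed
  qed
  then show "bump a s p x < bump a s p y" using inj[of x y] xy by simp
qed

lemma bump_left_slope:
  "left_slope (bump a s p) x
    (if x \<le> a then 1 else if x \<le> a + s then p else if x \<le> a + s + p * s then 1 / p else 1)"
proof -
  have ps: "p * s > 0" using s p by simp
  consider "x \<le> a" | "a < x" "x \<le> a + s" | "a + s < x" "x \<le> a + s + p * s" | "a + s + p * s < x"
    by linarith
  then show ?thesis
  proof cases
    case 1
    have "\<forall>\<^sub>F z in at_left x. z \<in> {x - 1<..<x}" by (rule eventually_at_left_real) simp
    then show ?thesis unfolding left_slope_def
      by eventually_elim (use 1 in \<open>simp add: bump_pieces(1)\<close>)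
  next
    case 2
    have "\<forall>\<^sub>F z in at_left x. z \<in> {a<..<x}" by (rule eventually_at_left_real) (use 2 in simp)
    then show ?thesis unfolding left_slope_def
      by eventually_elim (use 2 in \<open>simp add: bump_pieces(2) algebra_simps\<close>)
  next
    case 3
    have "\<forall>\<^sub>F z in at_left x. z \<in> {a + s<..<x}" by (rule eventually_at_left_real) (use 3 in simp)
    then show ?thesis unfolding left_slope_def
      by eventually_elim (use 3 s in \<open>simp add: bump_pieces(3) diff_divide_distrib\<close>)
  next
    case 4
    have "\<forall>\<^sub>F z in at_left x. z \<in> {a + s + p * s<..<x}"
      by (rule eventually_at_left_real) (use 4 in simp)
    then show ?thesis unfolding left_slope_def
      by eventually_elim (use 4 s ps in \<open>simp add: bump_pieces(4)\<close>)
  qed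
qed

lemma bump_right_slope:
  "right_slope (bump a s p) x
    (if x < a then 1 else if x < a + s then p else if x < a + s + p * s then 1 / p else 1)"
proof -
  have ps: "p * s > 0" using s p by simp
  consider "x < a" | "a \<le> x" "x < a + s" | "a + s \<le> x" "x < a + s + p * s" | "a + s + p * s \<le> x"
    by linarith
  then show ?thesis
  proof cases
    case 1
    have "\<forall>\<^sub>F z in at_right x. z \<in> {x<..<a}" by (rule eventually_at_right_real) (use 1 in simp)
    then show ?thesis unfolding right_slope_def
      by eventually_elim (use 1 in \<open>simp add: bump_pieces(1)\<close>)
  next
    case 2
    have "\<forall>\<^sub>F z in at_right x. z \<in> {x<..<a + s}" by (rule eventually_at_right_real) (use 2 in simp)
    then show ?thesis unfolding right_slope_def
      by eventually_elim (use 2 in \<open>simp add: bump_pieces(2) algebra_simps\<close>)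
  next
    case 3
    have "\<forall>\<^sub>F z in at_right x. z \<in> {x<..<a + s + p * s}"
      by (rule eventually_at_right_real) (use 3 in simp)
    then show ?thesis unfolding right_slope_def
      by eventually_elim (use 3 s in \<open>simp add: bump_pieces(3) diff_divide_distrib\<close>)
  next
    case 4
    have "\<forall>\<^sub>F z in at_right x. z \<in> {x<..<x + 1}" by (rule eventually_at_right_real) simp
    then show ?thesis unfolding right_slope_def
      by eventually_elim (use 4 s ps in \<open>simp add: bump_pieces(4)\<close>)
  qed
qed

lemma bump_piecewise_linear: "piecewise_linear (bump a s p)"
  unfolding piecewise_linear_def
proof (intro exI[of _ "{a, a + s, a + s + p * s}"] conjI allI impI)
  fix u v assume gap: "{u<..<v} \<inter> {a, a + s, a + s + p * s} = {}"
  have "\<exists>q c. \<forall>x\<in>{u<..<v}. bump a s p x = q * x + c"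
  proof (cases "u < v")
    case True
    then consider "v \<le> a" | "a \<le> u" "v \<le> a + s" | "a + s \<le> u" "v \<le> a + s + p * s" | "a + s + p * s \<le> u"
      using gap by force
    then show ?thesis
    proof cases
      case 1
      then show ?thesis by (intro exI[of _ 1] exI[of _ 0]) (simp add: bump_pieces(1))
    next
      case 2
      then show ?thesis
        by (intro exI[of _ p] exI[of _ "a - p * a"]) (simp add: bump_pieces(2) algebra_simps)
    next
      case 3
      then show ?thesis
        by (intro exI[of _ "1 / p"] exI[of _ "a + p * s - (a + s) / p"])
          (simp add: bump_pieces(3) diff_divide_distrib add_divide_distrib)
    next
      case 4
      then show ?thesis by (intro exI[of _ 1] exI[of _ 0]) (simp add: bump_pieces(4))
    qed
  qed auto
  then show "\<exists>f. affine_map f \<and> (\<forall>x\<in>{u<..<v}. bump a s p x = f x)"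
    unfolding affine_map_def by metis
qed simp

end

section \<open>The groups of piecewise linear maps\<close>

locale slope_data =
  fixes A P :: "real set"
  assumes P: "subgroup P pos_real_mult_group" "P \<noteq> {1}"
    and A: "subgroup A real_add_group" "A \<noteq> {0}"
    and stable: "\<And>p a. p \<in> P \<Longrightarrow> a \<in> A \<Longrightarrow> p * a \<in> A"
begin

lemma P_pos: "p \<in> P \<Longrightarrow> p > 0"
  using subgroup.subset[OF P(1)] by (auto simp: pos_real_mult_group_def)

lemma P_one: "1 \<in> P"
  using subgroup.one_closed[OF P(1)] by (simp add: pos_real_mult_group_def)

lemma P_mult: "p \<in> P \<Longrightarrow> q \<in> P \<Longrightarrow> p * q \<in> P"
  using subgroup.m_closed[OF P(1)] by (simp add: pos_real_mult_group_def)

lemma P_inverse: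
  assumes "p \<in> P"
  shows "1 / p \<in> P"
proof -
  have "m_inv pos_real_mult_group p = 1 / p"
    unfolding m_inv_def pos_real_mult_group_def
    by (rule the_equality) (use P_pos[OF assms] in \<open>auto simp: field_simps\<close>)
  then show ?thesis using subgroup.m_inv_closed[OF P(1) assms] by simp
qed

lemma A_zero: "0 \<in> A"
  using subgroup.one_closed[OF A(1)] by (simp add: real_add_group_def)

lemma A_add: "a \<in> A \<Longrightarrow> b \<in> A \<Longrightarrow> a + b \<in> A"
  using subgroup.m_closed[OF A(1)] by (simp add: real_add_group_def)

lemma A_minus:
  assumes "a \<in> A"
  shows "- a \<in> A"
proof -
  have "m_inv real_add_group a = - a"
    unfolding m_inv_def real_add_group_def by (rule the_equality) auto
  then show ?thesis using subgroup.m_inv_closed[OF A(1) assms] by simp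
qed

lemma A_diff: "a \<in> A \<Longrightarrow> b \<in> A \<Longrightarrow> a - b \<in> A"
  using A_add[of a "- b"] A_minus[of b] by simp

lemma slope_above_one: "\<exists>p\<in>P. p > 1"
proof -
  obtain p where p: "p \<in> P" "p \<noteq> 1" using P P_one by blast
  show ?thesis
  proof (cases "p > 1")
    case False
    then have "1 / p > 1" using p P_pos[OF p(1)] by simp
    then show ?thesis using P_inverse p by blast
  qed (use p in blast)
qed

text \<open>
  Multiplication by high powers of a slope below \<open>1\<close> shrinks a nonzero element of \<open>A\<close>.
\<close>

lemma A_small:
  assumes "\<epsilon> > 0"
  shows "\<exists>s\<in>A. 0 < s \<and> s < \<epsilon>"
proof -
  obtain a where "a \<in> A" "a \<noteq> 0" using A A_zero by blast
  then have a: "\<bar>a\<bar> \<in> A" "\<bar>a\<bar> > 0" using A_minus by (auto simp: abs_if)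
  obtain p where p: "p \<in> P" "p > 1" using slope_above_one by blast
  obtain k where k: "(1 / p) ^ k < \<epsilon> / \<bar>a\<bar>"
    using real_arch_pow_inv[of "\<epsilon> / \<bar>a\<bar>" "1 / p"] assms a p by auto
  have "(1 / p) ^ k \<in> P"
  proof (induction k)
    case (Suc k)
    then show ?case using P_mult[OF P_inverse[OF p(1)]] by simp
  qed (simp add: P_one)
  then have "(1 / p) ^ k * \<bar>a\<bar> \<in> A" using stable a by blast
  moreover have "(1 / p) ^ k * \<bar>a\<bar> < \<epsilon>" using k a by (simp add: pos_less_divide_eq)
  moreover have "(1 / p) ^ k * \<bar>a\<bar> > 0" using p a by simp
  ultimately show ?thesis by blast
qed

lemma A_dense:
  assumes "x < y"
  shows "\<exists>a\<in>A. x < a \<and> a < y"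
proof -
  obtain s where s: "s \<in> A" "0 < s" "s < y - x" using A_small[of "y - x"] assms by auto
  have nat_mult: "real n * s \<in> A" for n
    by (induction n) (use A_zero A_add s in \<open>auto simp: algebra_simps\<close>)
  have "of_int k * s \<in> A" for k
  proof (cases "k \<ge> 0")
    case True
    then show ?thesis using nat_mult[of "nat k"] by simp
  next
    case False
    then show ?thesis using A_minus[OF nat_mult[of "nat (- k)"]] by simp
  qed
  moreover define k where "k = \<lfloor>x / s\<rfloor> + 1"
  have "x / s < of_int k" "of_int k \<le> x / s + 1" unfolding k_def by linarith+
  then have "x < of_int k * s" "of_int k * s \<le> x + s" using s by (simp_all add: field_simps)
  ultimately show ?thesis using s by (intro bexI[of _ "of_int k * s"]) auto
qed

lemma bump_maps_A:
  assumes "a \<in> A" "s \<in> A" "p \<in> P" "x \<in> A"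
  shows "bump a s p x \<in> A"
proof -
  have "1 / p * (x - a - s) \<in> A" by (intro stable P_inverse A_diff assms)
  then show ?thesis unfolding bump_def using assms by (auto intro!: A_add A_diff stable)
qed

lemma bump_in_PL:
  assumes "a \<in> A" "s \<in> A" "p \<in> P" "s > 0"
  shows "bump a s p \<in> PL A P"
proof -
  have p: "p > 0" using P_pos assms by simp
  have ps: "p * s > 0" "1 / p > 0" "1 / p * (p * s) = s" "1 / (1 / p) = p" using p assms by simp_all
  have inv1: "bump a (p * s) (1 / p) (bump a s p x) = x" for x
    by (rule bump_inverse[OF assms(4) p])
  have inv2: "bump a s p (bump a (p * s) (1 / p) x) = x" for x
    using bump_inverse[OF ps(1,2), of a x] by (simp only: ps)
  show ?thesis
  proof (rule PL_intro)
    show "strict_mono (bump a s p)" using bump_strict_mono assms(4) p by blast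
    show "surj (bump a s p)" using inv2 by (metis surjI)
    show "piecewise_linear (bump a s p)" using bump_piecewise_linear assms(4) p by blast
    show "\<exists>l\<in>P. left_slope (bump a s p) x l" for x
      using bump_left_slope[OF assms(4) p, of a x] assms(3) P_one P_inverse[OF assms(3)]
      by (auto split: if_splits)
    show "\<exists>r\<in>P. right_slope (bump a s p) x r" for x
      using bump_right_slope[OF assms(4) p, of a x] assms(3) P_one P_inverse[OF assms(3)]
      by (auto split: if_splits)
    show "finite {a, a + s, a + s + p * s}" by simp
    show "{a, a + s, a + s + p * s} \<subseteq> A" using assms by (auto intro!: A_add stable)
    show "\<exists>l. left_slope (bump a s p) x l \<and> right_slope (bump a s p) x l"
      if "x \<notin> {a, a + s, a + s + p * s}" for x
    proof -
      have strict: "(x \<le> a) = (x < a)" "(x \<le> a + s) = (x < a + s)" "(x \<le> a + s + p * s) = (x < a + s + p * s)"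
        using that by auto
      show ?thesis
        using bump_left_slope[OF assms(4) p, of a x, unfolded strict]
          bump_right_slope[OF assms(4) p, of a x] by blast
    qed
    show "bump a s p ` A = A"
    proof
      show "bump a s p ` A \<subseteq> A" using bump_maps_A assms by blast
      show "A \<subseteq> bump a s p ` A"
      proof
        fix x assume "x \<in> A"
        then have "bump a (p * s) (1 / p) x \<in> A"
          using assms by (intro bump_maps_A stable P_inverse)
        then have "bump a s p (bump a (p * s) (1 / p) x) \<in> bump a s p ` A" by (rule imageI)
        then show "x \<in> bump a s p ` A" by (simp only: inv2)
      qed
    qed
  qed
qed

text \<open>
  The group of bounded elements, and with it \<open>G\<close>, is locally moving: as \<open>A\<close> is dense, a bump
  with slope \<open>p > 1\<close> fits between \<open>l\<close> and \<open>r\<close> with \<open>x\<close> on its first piece, where it lies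
  above the diagonal.
\<close>

lemma PL_bounded_moves:
  assumes "l < x" "x < r"
  shows "\<exists>g\<in>PL_bounded A P. supp g \<subseteq> {l<..<r} \<and> x < g x"
proof -
  obtain p where p: "p \<in> P" "p > 1" using slope_above_one by blast
  obtain s where s: "s \<in> A" "0 < s" "s < min (x - l) ((r - x) / (1 + p))"
    using A_small[of "min (x - l) ((r - x) / (1 + p))"] assms p by auto
  obtain a where a: "a \<in> A" "x - s < a" "a < x" using A_dense[of "x - s" x] s by auto
  have "s * (1 + p) < r - x" using s p by (simp add: pos_less_divide_eq)
  then have end_less: "a + s + p * s < r" using a by (simp add: algebra_simps)
  have p0: "p > 0" using p by simp
  note pieces = bump_pieces[OF s(2) p0, where a = a]
  have fixed: "bump a s p y = y" if "y \<le> a \<or> a + s + p * s \<le> y" for y using that pieces(1,4) by blast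
  have "bump a s p \<in> PL A P" using bump_in_PL a s p by blast
  moreover have "\<forall>\<^sub>F y in at_bot. bump a s p y = y"
    using eventually_le_at_bot[of a] by eventually_elim (simp add: fixed)
  moreover have "\<forall>\<^sub>F y in at_top. bump a s p y = y"
    using eventually_ge_at_top[of "a + s + p * s"] by eventually_elim (simp add: fixed)
  ultimately have "bump a s p \<in> PL_bounded A P" by (simp add: PL_bounded_def)
  moreover have "supp (bump a s p) \<subseteq> {l<..<r}"
  proof
    fix y assume "y \<in> supp (bump a s p)"
    then have "\<not> (y \<le> a \<or> a + s + p * s \<le> y)" using fixed[of y] by (auto simp: supp_def)
    then show "y \<in> {l<..<r}" using a s end_less by auto
  qed
  moreover have "x < bump a s p x"
  proof -
    have "(x - a) * 1 < (x - a) * p" using a p by (intro mult_strict_left_mono) auto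
    then show ?thesis using pieces(2)[of x] a by (simp add: algebra_simps)
  qed
  ultimately show ?thesis by blast
qed

text \<open>
  Needed to see that inverses in the group record are inverse maps: the record inverse is
  a definite description, which picks an element of the carrier.
\<close>

lemma PL_inverse_closed:
  assumes "g \<in> PL A P"
  shows "inv g \<in> PL A P"
proof -
  have g: "g \<in> PLo" "slopes g \<subseteq> P" "break_points g \<subseteq> A" "g ` A = A" using assms by (auto simp: PL_def)
  have sm: "strict_mono g" and sj: "surj g" using PLo_strict_mono PLo_surj g(1) by auto
  have inj: "inj g" using sm by (simp add: strict_mono_on_imp_inj_on)
  have gi: "g (inv g y) = y" for y using sj by (simp add: surj_f_inv_f)
  have left: "\<exists>l\<in>P. left_slope g x l" and right: "\<exists>r\<in>P. right_slope g x r" for x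
    using PLo_slopes_exist[OF g(1)] slope_in_slopes g(2) by blast+
  show ?thesis
  proof (rule PL_intro)
    show "strict_mono (inv g)"
      by (rule strict_monoI) (metis gi sm strict_mono_less)
    show "surj (inv g)" using inj by (rule inj_imp_surj_inv)
    show "piecewise_linear (inv g)" using g(1) sm sj by (intro piecewise_linear_inv) (auto simp: PLo_def)
    show "\<exists>l\<in>P. left_slope (inv g) y l" for y
      using left[of "inv g y"] left_slope_inv[OF sm sj, of "inv g y"] P_pos P_inverse by (metis gi)
    show "\<exists>r\<in>P. right_slope (inv g) y r" for y
      using right[of "inv g y"] right_slope_inv[OF sm sj, of "inv g y"] P_pos P_inverse by (metis gi)
    show "finite (g ` break_points g)" using g(1) by (simp add: PLo_def)
    show "g ` break_points g \<subseteq> A" using g(3,4) by blast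
    show "\<exists>l. left_slope (inv g) y l \<and> right_slope (inv g) y l" if "y \<notin> g ` break_points g" for y
    proof -
      have nb: "inv g y \<notin> break_points g" using that gi by (metis imageI)
      obtain l r where lr: "l \<in> P" "left_slope g (inv g y) l" "right_slope g (inv g y) r"
        using left right by metis
      then have "l = r" using break_point_iff nb by blast
      then show ?thesis
        using left_slope_inv[OF sm sj lr(2)] right_slope_inv[OF sm sj lr(3)] P_pos[OF lr(1)] gi by auto
    qed
    have "inv g ` (g ` A) = A" using inj by (simp add: image_comp)
    then show "inv g ` A = A" by (simp add: g(4))
  qed
qed

lemma PL_Bij: "g \<in> PL A P \<Longrightarrow> g \<in> Bij UNIV"
  using PLo_surj PLo_strict_mono
  by (auto simp: PL_def Bij_def bij_betw_def strict_mono_on_imp_inj_on)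

lemma PL_group_mult:
  "f \<in> PL A P \<Longrightarrow> g \<in> PL A P \<Longrightarrow> mult (PL_group A P) f g = f \<circ> g"
  by (auto simp: PL_group_def BijGroup_def PL_Bij compose_def)

lemma PL_group_one: "one (PL_group A P) = id"
  by (auto simp: PL_group_def BijGroup_def)

lemma PL_group_inv:
  assumes "g \<in> PL A P"
  shows "m_inv (PL_group A P) g = inv g"
  unfolding m_inv_def
proof (rule the_equality)
  have car: "carrier (PL_group A P) = PL A P" by (simp add: PL_group_def)
  have bij: "bij g" using PL_Bij[OF assms] by (simp add: Bij_def)
  show "inv g \<in> carrier (PL_group A P) \<and> mult (PL_group A P) g (inv g) = one (PL_group A P) \<and>
      mult (PL_group A P) (inv g) g = one (PL_group A P)"
    using PL_inverse_closed[OF assms] assms bij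
    by (auto simp: car PL_group_mult PL_group_one fun_eq_iff bij_is_inj bij_is_surj surj_f_inv_f)
  fix y assume "y \<in> carrier (PL_group A P) \<and> mult (PL_group A P) g y = one (PL_group A P) \<and>
      mult (PL_group A P) y g = one (PL_group A P)"
  then have "g \<circ> y = id" using PL_group_mult[OF assms, of y] by (simp add: car PL_group_one)
  then show "y = inv g" using bij by (metis bij_is_inj inv_o_cancel o_assoc comp_id id_comp)
qed

end

lemma affine_Bij: "p > 0 \<Longrightarrow> (\<lambda>x. p * x + b) \<in> Bij (UNIV :: real set)"
  unfolding Bij_def
  by (auto simp: bij_def inj_def surj_def intro!: exI[of _ "(y - b) / p" for y])

text \<open>
  The map \<open>\<gamma>\<close>, which sends an element to its affine germ, is multiplicative because positive
  slopes preserve the end, so its image inherits the group laws from \<open>G\<close>. The two sides of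
  the last hypothesis are the constant terms of the two compositions of a pair of germs; the
  slopes of these compositions agree anyway.
\<close>

lemma comm_group_of_commuting_germs:
  fixes \<gamma> :: "(real \<Rightarrow> real) \<Rightarrow> real \<Rightarrow> real"
  assumes F: "line_end F"
    and G: "id \<in> G" "\<And>f g. f \<in> G \<Longrightarrow> g \<in> G \<Longrightarrow> f \<circ> g \<in> G" "\<And>f. f \<in> G \<Longrightarrow> inv f \<in> G"
      "\<And>f. f \<in> G \<Longrightarrow> bij f"
    and germ: "\<And>g. g \<in> G \<Longrightarrow> \<exists>p b. p > 0 \<and> has_germ F g p b"
    and \<gamma>: "\<And>g p b. has_germ F g p b \<Longrightarrow> \<gamma> g = (\<lambda>x. p * x + b)"
    and comm: "\<And>f g p b q c. f \<in> G \<Longrightarrow> g \<in> G \<Longrightarrow> has_germ F f p b \<Longrightarrow> has_germ F g q c \<Longrightarrow>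
      p * c + b = q * b + c"
  shows "comm_group ((Aff_group A P)\<lparr>carrier := \<gamma> ` G\<rparr>)"
proof -
  let ?H = "(Aff_group A P)\<lparr>carrier := \<gamma> ` G\<rparr>"
  have \<gamma>_Bij: "\<gamma> f \<in> Bij UNIV" if "f \<in> G" for f
    using germ[OF that] \<gamma> affine_Bij by metis
  have \<gamma>_comp: "\<gamma> f \<circ> \<gamma> g = \<gamma> (f \<circ> g)" if fg: "f \<in> G" "g \<in> G" for f g
  proof -
    obtain p b where 1: "p > 0" "has_germ F f p b" using germ fg by blast
    obtain q c where 2: "q > 0" "has_germ F g q c" using germ fg by blast
    show ?thesis
      using \<gamma>[OF 1(2)] \<gamma>[OF 2(2)] \<gamma>[OF has_germ_comp[OF F 1(2) 2(2) 2(1)]]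
      by (auto simp: algebra_simps)
  qed
  have \<gamma>_commute: "\<gamma> (f \<circ> g) = \<gamma> (g \<circ> f)" if fg: "f \<in> G" "g \<in> G" for f g
  proof -
    obtain p b where 1: "p > 0" "has_germ F f p b" using germ fg by blast
    obtain q c where 2: "q > 0" "has_germ F g q c" using germ fg by blast
    show ?thesis
      using \<gamma>[OF has_germ_comp[OF F 1(2) 2(2) 2(1)]] \<gamma>[OF has_germ_comp[OF F 2(2) 1(2) 1(1)]]
        comm[OF fg 1(2) 2(2)] by (simp add: mult.commute)
  qed
  have mult: "mult ?H (\<gamma> f) (\<gamma> g) = \<gamma> (f \<circ> g)" if "f \<in> G" "g \<in> G" for f g
    using that \<gamma>_comp[OF that] by (auto simp: Aff_group_def BijGroup_def \<gamma>_Bij compose_def comp_def)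
  have "has_germ F id 1 0" by (simp add: has_germ_def)
  then have one: "one ?H = \<gamma> id"
    using \<gamma>[of id 1 0] by (auto simp: Aff_group_def BijGroup_def)
  show ?thesis
  proof (rule comm_groupI)
    show "mult ?H x y \<in> carrier ?H" if "x \<in> carrier ?H" "y \<in> carrier ?H" for x y
      using that mult G(2) by auto
    show "one ?H \<in> carrier ?H" unfolding one using G(1) by simp
    show "mult ?H (mult ?H x y) z = mult ?H x (mult ?H y z)"
      if "x \<in> carrier ?H" "y \<in> carrier ?H" "z \<in> carrier ?H" for x y z
    proof -
      obtain f g h where "x = \<gamma> f" "y = \<gamma> g" "z = \<gamma> h" "f \<in> G" "g \<in> G" "h \<in> G"
        using \<open>x \<in> carrier ?H\<close> \<open>y \<in> carrier ?H\<close> \<open>z \<in> carrier ?H\<close> by auto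
      then show ?thesis by (simp only: mult G(2) comp_assoc)
    qed
    show "mult ?H x y = mult ?H y x" if "x \<in> carrier ?H" "y \<in> carrier ?H" for x y
      using that mult \<gamma>_commute by auto
    show "mult ?H (one ?H) x = x" if "x \<in> carrier ?H" for x
    proof -
      obtain f where "x = \<gamma> f" "f \<in> G" using \<open>x \<in> carrier ?H\<close> by auto
      then show ?thesis unfolding one using G(1) by (simp only: mult id_comp)
    qed
    show "\<exists>y\<in>carrier ?H. mult ?H y x = one ?H" if "x \<in> carrier ?H" for x
    proof -
      obtain f where f: "x = \<gamma> f" "f \<in> G" using \<open>x \<in> carrier ?H\<close> by auto
      have "mult ?H (\<gamma> (inv f)) x = one ?H"
        unfolding one f(1) using f(2) G(3,4) by (simp only: mult) (simp add: bij_is_inj)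
      then show ?thesis using G(3) f(2) by (intro bexI[of _ "\<gamma> (inv f)"]) simp_all
    qed
  qed
qed

section \<open>Automorphisms preserve the product of the end slopes\<close>

theorem theorem5p5:
  fixes A P :: "real set" and G :: "(real \<Rightarrow> real) set"
    and \<alpha> :: "(real \<Rightarrow> real) \<Rightarrow> (real \<Rightarrow> real)"
  assumes P: "subgroup P pos_real_mult_group" "P \<noteq> {1}"
    and A: "subgroup A real_add_group" "A \<noteq> {0}"
    and stable: "\<And>p a. p \<in> P \<Longrightarrow> a \<in> A \<Longrightarrow> p * a \<in> A"
    and G: "subgroup G (PL_group A P)" "PL_bounded A P \<subseteq> G"
    and left_nonabelian: "\<not> comm_group ((Aff_group A P)\<lparr>carrier := germ_left ` G\<rparr>)"
    and right_nonabelian: "\<not> comm_group ((Aff_group A P)\<lparr>carrier := germ_right ` G\<rparr>)"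
    and \<alpha>: "\<alpha> \<in> iso ((PL_group A P)\<lparr>carrier := G\<rparr>) ((PL_group A P)\<lparr>carrier := G\<rparr>)"
  shows "\<forall>g\<in>G. psi (\<alpha> g) = psi g"
proof
  fix g assume g: "g \<in> G"
  interpret slope_data A P by (rule slope_data.intro[OF P A stable])
  have GPL: "f \<in> PL A P" if "f \<in> G" for f
    using subgroup.subset[OF G(1)] that by (auto simp: PL_group_def)
  then have PLo: "f \<in> PLo" if "f \<in> G" for f
    using that by (simp add: PL_def)
  interpret automorphism G \<alpha>
  proof
    show "f \<circ> h \<in> G" if "f \<in> G" "h \<in> G" for f h
      using subgroup.m_closed[OF G(1) that] that by (simp add: PL_group_mult GPL)
    show "inv f \<in> G" if "f \<in> G" for f
      using subgroup.m_inv_closed[OF G(1) that] that by (simp add: PL_group_inv GPL)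
    show "strict_mono f" "surj f" if "f \<in> G" for f
      using PLo[OF that] by (rule PLo_strict_mono, rule PLo_surj)
    show "\<exists>f\<in>G. supp f \<subseteq> {l<..<r} \<and> x < f x" if "l < x" "x < r" for l x r
      using PL_bounded_moves[OF that] G(2) by blast
    show bij: "bij_betw \<alpha> G G" using \<alpha> by (simp add: iso_def)
    fix f h assume fh: "f \<in> G" "h \<in> G"
    then have "\<alpha> f \<in> G" "\<alpha> h \<in> G" using bij_betwE[OF bij] by auto
    then show "\<alpha> (f \<circ> h) = \<alpha> f \<circ> \<alpha> h"
      using \<alpha> fh by (simp add: iso_def hom_def PL_group_mult GPL)
  qed
  have germ: "\<exists>p b. p > 0 \<and> has_germ F f p b" if F: "line_end F" and f: "f \<in> G" for F f
  proof -
    obtain p b where pb: "has_germ F f p b" using PLo_has_germ[OF PLo[OF f] F] by blast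
    then have "p \<in> P" using has_germ_in_slopes[OF F] GPL[OF f] by (auto simp: PL_def)
    then show ?thesis using pb P_pos by blast
  qed
  have nonabelian: "\<exists>f\<in>G. \<exists>h\<in>G. \<exists>p b q c. has_germ F f p b \<and> has_germ F h q c \<and> p * c + b \<noteq> q * b + c"
    if F: "line_end F" "\<not> comm_group ((Aff_group A P)\<lparr>carrier := \<gamma> ` G\<rparr>)"
      and \<gamma>: "\<And>f p b. has_germ F f p b \<Longrightarrow> \<gamma> f = (\<lambda>x. p * x + b)" for F \<gamma>
  proof (rule ccontr)
    assume "\<not> ?thesis"
    then have commute: "p * c + b = q * b + c"
      if "f \<in> G" "h \<in> G" "has_germ F f p b" "has_germ F h q c" for f h p b q c
      using that by blast
    have "comm_group ((Aff_group A P)\<lparr>carrier := \<gamma> ` G\<rparr>)"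
      by (rule comm_group_of_commuting_germs[OF F(1) id_in comp inverse bij germ[OF F(1)] \<gamma> commute])
    then show False using F(2) by blast
  qed
  have left: "\<exists>f\<in>G. \<exists>h\<in>G. \<exists>p b q c. has_germ at_bot f p b \<and> has_germ at_bot h q c \<and> p * c + b \<noteq> q * b + c"
    by (rule nonabelian[OF _ left_nonabelian]) (simp_all add: germ_left_def the_end_germ)
  have right: "\<exists>f\<in>G. \<exists>h\<in>G. \<exists>p b q c. has_germ at_top f p b \<and> has_germ at_top h q c \<and> p * c + b \<noteq> q * b + c"
    by (rule nonabelian[OF _ right_nonabelian]) (simp_all add: germ_right_def the_end_germ)
  obtain p b where p: "has_germ at_bot g p b" using PLo_has_germ PLo g by (meson line_end_simps)
  obtain q c where q: "has_germ at_top g q c" using PLo_has_germ PLo g by (meson line_end_simps)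
  obtain p' b' where p': "has_germ at_bot (\<alpha> g) p' b'"
    using PLo_has_germ PLo closed g by (meson line_end_simps)
  obtain q' c' where q': "has_germ at_top (\<alpha> g) q' c'"
    using PLo_has_germ PLo closed g by (meson line_end_simps)
  have psi_germs: "psi f = u * v" if "has_germ at_bot f u d" "has_germ at_top f v e" for f u v d e
    using that by (simp add: psi_def slope_left_def slope_right_def the_end_slope)
  obtain \<phi> :: "real \<Rightarrow> real" where \<phi>: "surj \<phi>" "strict_mono \<phi> \<or> (\<forall>x y. x < y \<longrightarrow> \<phi> y < \<phi> x)"
      "\<And>f x. f \<in> G \<Longrightarrow> \<alpha> f (\<phi> x) = \<phi> (f x)"
    using induced_by_conjugation by blast
  from \<phi>(2) have "p' * q' = p * q"
  proof
    assume "strict_mono \<phi>"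
    note lim = filterlim_increasing_surj[OF this \<phi>(1)]
    have "p = p'"
      by (rule end_slope_invariant[OF _ _ germ \<phi>(2) lim(2) \<phi>(3) left g p p']) simp_all
    moreover have "q = q'"
      by (rule end_slope_invariant[OF _ _ germ \<phi>(2) lim(1) \<phi>(3) right g q q']) simp_all
    ultimately show ?thesis by simp
  next
    assume "\<forall>x y. x < y \<longrightarrow> \<phi> y < \<phi> x"
    then have lim: "filterlim \<phi> at_top at_bot" "filterlim \<phi> at_bot at_top"
      using filterlim_decreasing_surj[OF _ \<phi>(1)] by blast+
    have "p = q'"
      by (rule end_slope_invariant[OF _ _ germ \<phi>(2) lim(1) \<phi>(3) left g p q']) simp_all
    moreover have "q = p'"
      by (rule end_slope_invariant[OF _ _ germ \<phi>(2) lim(2) \<phi>(3) right g q p']) simp_all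
    ultimately show ?thesis by simp
  qed
  then show "psi (\<alpha> g) = psi g" using psi_germs p q p' q' by simp
qed

end
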